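(* Let $R=\bigoplus_{\alpha\in\Gamma}R_\alpha$ be a graded integral domain. The canonical bijection $$\varphi:\operatorname{Zar}(\operatorname{Kr_h}(R,b))\to\operatorname{Zar}_h(R),\qquad W\mapsto\bigoplus_{\alpha\in\langle\Gamma\rangle}(W\cap(R_H)_\alpha)$$ is a homeomorphism when both spaces are endowed with their Zariski topologies.
   Context: $\Gamma$ is a nonzero torsionless commutative cancellative monoid (written additively) with quotient group $\langle\Gamma\rangle$; $R=\bigoplus_{\alpha\in\Gamma}R_\alpha$ is an integral domain graded by $\Gamma$, with quotient field $K$; $H$ is the set of nonzero homogeneous elements of $R$, and $R_H$ is the $\langle\Gamma\rangle$-graded localization with $(R_H)_\alpha=\{a/b\mid a\in R_\beta,\ 0\neq b\in R_\gamma,\ \beta-\gamma=\alpha\}$. A homogeneous overring of $R$ is a ring $A$ with $R\subseteq A\subseteq R_H$ and $A=\bigoplus_{\alpha\in\langle\Gamma\rangle}(A\cap(R_H)_\alpha)$. A gr-valuation overring of $R$ is a homogeneous overring $V$ such that for every nonzero homogeneous $x\in R_H$, $x\in V$ or $x^{-1}\in V$. A gr-valuation domain $V$ has a unique homogeneous maximal ideal $M_V$ (maximal among proper homogeneous ideals), and $V_{M_V}$ is a valuation domain. $\operatorname{Zar}_h(R)$ is the set of all gr-valuation overrings of $R$; its Zariski topology has as subbasic open sets the sets $\operatorname{Zar}_h(R[u])=\{V\in\operatorname{Zar}_h(R)\mid u\in V\}$, $u$ ranging over homogeneous elements of $R_H$. For an integral domain $D$ with quotient field $L$, $\operatorname{Zar}(D)$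 is the set of all valuation rings $W$ with $D\subseteq W\subseteq L$ and quotient field $L$; its Zariski topology has as subbasic open sets the sets $\operatorname{Zar}(D[x])=\{W\in\operatorname{Zar}(D)\mid x\in W\}$, $x\in L$. The $b$-operation is the semistar operation on $R$ given by $E^b=\bigcap\{EV\mid V\in\operatorname{Zar}(R)\}$ for each nonzero $R$-submodule $E$ of $K$. For $a\in R$, $C(a)$ is the ideal of $R$ generated by the homogeneous components of $a$; for $f=f_0+f_1X+\cdots+f_nX^n\in R[X]$, put $\mathcal A_f:=\sum_{i=0}^nC(f_i)$. The homogeneous Kronecker function ring of $R$ with respect to $b$ is $$\operatorname{Kr_h}(R,b):=\left\{\tfrac fg\ \middle|\ f,g\in R[X],\ g\ne0,\text{ and there is }0\ne h\in R[X]\text{ with }\mathcal A_f\mathcal A_h\subseteq(\mathcal A_g\mathcal A_h)^b\right\},$$ an integral domain with quotient field $K(X)$. The map $\varphi$ is a bijection with inverse $V\mapsto V_{M_V}(X)$, where for a valuation domain $U$ with maximal ideal $N$, $U(X)=U[X]_{N[X]}$. *)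

theory Defs
  imports
    "HOL-Analysis.Abstract_Topology"
    "HOL-Computational_Algebra.Polynomial_Factorial"
begin

text \<open>
  All integral domains are subrings of an ambient field type, and modules are subsets of it.
\<close>

definition is_subring :: "'k::field set \<Rightarrow> bool" where
  "is_subring A \<longleftrightarrow> 0 \<in> A \<and> 1 \<in> A \<and>
     (\<forall>x\<in>A. \<forall>y\<in>A. x + y \<in> A \<and> x - y \<in> A \<and> x * y \<in> A)"

definition is_add_subgroup :: "'k::ab_group_add set \<Rightarrow> bool" where
  "is_add_subgroup A \<longleftrightarrow> 0 \<in> A \<and> (\<forall>x\<in>A. \<forall>y\<in>A. x - y \<in> A)"

definition quotient_field :: "'k::field set \<Rightarrow> 'k set" where
  "quotient_field A = {a / b | a b. a \<in> A \<and> b \<in> A \<and> b \<noteq> 0}"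

definition sum_family :: "'i set \<Rightarrow> ('i \<Rightarrow> 'k::ab_group_add set) \<Rightarrow> 'k set" where
  "sum_family I A = {(\<Sum>i\<in>F. x i) | F x. finite F \<and> F \<subseteq> I \<and> (\<forall>i\<in>F. x i \<in> A i)}"

definition independent_family :: "'i set \<Rightarrow> ('i \<Rightarrow> 'k::ab_group_add set) \<Rightarrow> bool" where
  "independent_family I A \<longleftrightarrow>
     (\<forall>F x. finite F \<and> F \<subseteq> I \<and> (\<forall>i\<in>F. x i \<in> A i) \<and> (\<Sum>i\<in>F. x i) = 0 \<longrightarrow> (\<forall>i\<in>F. x i = 0))"

definition is_direct_sum :: "'k::ab_group_add set \<Rightarrow> 'i set \<Rightarrow> ('i \<Rightarrow> 'k set) \<Rightarrow> bool" where
  "is_direct_sum S I A \<longleftrightarrow> S = sum_family I A \<and> independent_family I A"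

text \<open>
  The additive span of all products. It is the product of two ideals, the extension \<open>EV\<close> of a
  module to a ring \<open>V\<close>, and, with second argument a ring \<open>R\<close>, the \<open>R\<close>-module generated by the
  first argument.
\<close>

definition span_prod :: "'k::comm_ring set \<Rightarrow> 'k set \<Rightarrow> 'k set" where
  "span_prod A B =
     {(\<Sum>i<n. a i * b i) | (n::nat) a b. (\<forall>i<n. a i \<in> A) \<and> (\<forall>i<n. b i \<in> B)}"

text \<open>
  The cancellative monoid \<open>\<Gamma>\<close> is a submonoid of an abelian group; the differences of its elements
  form its quotient group. The sum \<open>\<Sum>i<n. \<alpha>\<close> is the multiple \<open>n\<alpha>\<close>.
\<close>

definition torsionless_monoid :: "'g::ab_group_add set \<Rightarrow> bool" where
  "torsionless_monoid \<Gamma> \<longleftrightarrow> 0 \<in> \<Gamma> \<and> (\<forall>\<alpha>\<in>\<Gamma>. \<forall>\<beta>\<in>\<Gamma>. \<alpha> + \<beta> \<in> \<Gamma>) \<and>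
     (\<forall>\<alpha>\<in>\<Gamma>. \<forall>\<beta>\<in>\<Gamma>. \<forall>n::nat. n > 0 \<and> (\<Sum>i<n. \<alpha>) = (\<Sum>i<n. \<beta>) \<longrightarrow> \<alpha> = \<beta>)"

definition quotient_group :: "'g::ab_group_add set \<Rightarrow> 'g set" where
  "quotient_group \<Gamma> = {\<alpha> - \<beta> | \<alpha> \<beta>. \<alpha> \<in> \<Gamma> \<and> \<beta> \<in> \<Gamma>}"

text \<open>
  \<open>G \<alpha>\<close> is the homogeneous part \<open>R\<^sub>\<alpha>\<close>, relevant only for \<open>\<alpha> \<in> \<Gamma>\<close>. The whole type \<open>'k\<close> is the
  quotient field \<open>K\<close> of \<open>R\<close>.
\<close>

locale graded_domain =
  fixes \<Gamma> :: "'g::ab_group_add set" and R :: "'k::field set" and G :: "'g \<Rightarrow> 'k set"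
  assumes monoid: "torsionless_monoid \<Gamma>"
    and nonzero_monoid: "\<Gamma> \<noteq> {0}"
    and subring: "is_subring R"
    and quotient_field: "quotient_field R = UNIV"
    and parts: "\<alpha> \<in> \<Gamma> \<Longrightarrow> is_add_subgroup (G \<alpha>)"
    and direct_sum: "is_direct_sum R \<Gamma> G"
    and mult: "\<alpha> \<in> \<Gamma> \<Longrightarrow> \<beta> \<in> \<Gamma> \<Longrightarrow> a \<in> G \<alpha> \<Longrightarrow> b \<in> G \<beta> \<Longrightarrow> a * b \<in> G (\<alpha> + \<beta>)"

definition nonzero_homogeneous :: "'g set \<Rightarrow> ('g \<Rightarrow> 'k::field set) \<Rightarrow> 'k set" where
  "nonzero_homogeneous \<Gamma> G = (\<Union>\<alpha>\<in>\<Gamma>. G \<alpha>) - {0}"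

definition hom_localization :: "'g set \<Rightarrow> 'k::field set \<Rightarrow> ('g \<Rightarrow> 'k set) \<Rightarrow> 'k set" where
  "hom_localization \<Gamma> R G = {a / b | a b. a \<in> R \<and> b \<in> nonzero_homogeneous \<Gamma> G}"

definition hom_localization_part ::
  "'g::ab_group_add set \<Rightarrow> ('g \<Rightarrow> 'k::field set) \<Rightarrow> 'g \<Rightarrow> 'k set" where
  "hom_localization_part \<Gamma> G \<alpha> =
     {a / b | a b \<beta> \<gamma>. \<beta> \<in> \<Gamma> \<and> \<gamma> \<in> \<Gamma> \<and> a \<in> G \<beta> \<and> b \<in> G \<gamma> \<and> b \<noteq> 0 \<and> \<beta> - \<gamma> = \<alpha>}"

definition hom_localization_homogeneous ::
  "'g::ab_group_add set \<Rightarrow> ('g \<Rightarrow> 'k::field set) \<Rightarrow> 'k set" where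
  "hom_localization_homogeneous \<Gamma> G = (\<Union>\<alpha>\<in>quotient_group \<Gamma>. hom_localization_part \<Gamma> G \<alpha>)"

definition homogeneous_overring ::
  "'g::ab_group_add set \<Rightarrow> 'k::field set \<Rightarrow> ('g \<Rightarrow> 'k set) \<Rightarrow> 'k set \<Rightarrow> bool" where
  "homogeneous_overring \<Gamma> R G A \<longleftrightarrow>
     is_subring A \<and> R \<subseteq> A \<and> A \<subseteq> hom_localization \<Gamma> R G \<and>
     is_direct_sum A (quotient_group \<Gamma>) (\<lambda>\<alpha>. A \<inter> hom_localization_part \<Gamma> G \<alpha>)"

definition gr_valuation_overring ::
  "'g::ab_group_add set \<Rightarrow> 'k::field set \<Rightarrow> ('g \<Rightarrow> 'k set) \<Rightarrow> 'k set \<Rightarrow> bool" where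
  "gr_valuation_overring \<Gamma> R G V \<longleftrightarrow>
     homogeneous_overring \<Gamma> R G V \<and>
     (\<forall>x\<in>hom_localization_homogeneous \<Gamma> G. x \<noteq> 0 \<longrightarrow> x \<in> V \<or> inverse x \<in> V)"

definition Zar_h :: "'g::ab_group_add set \<Rightarrow> 'k::field set \<Rightarrow> ('g \<Rightarrow> 'k set) \<Rightarrow> 'k set set" where
  "Zar_h \<Gamma> R G = {V. gr_valuation_overring \<Gamma> R G V}"

definition Zar_h_topology ::
  "'g::ab_group_add set \<Rightarrow> 'k::field set \<Rightarrow> ('g \<Rightarrow> 'k set) \<Rightarrow> 'k set topology" where
  "Zar_h_topology \<Gamma> R G = topology_generated_by
     {{V \<in> Zar_h \<Gamma> R G. u \<in> V} | u. u \<in> hom_localization_homogeneous \<Gamma> G}"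

definition valuation_ring :: "'k::field set \<Rightarrow> bool" where
  "valuation_ring W \<longleftrightarrow>
     is_subring W \<and> (\<forall>x\<in>quotient_field W. x \<noteq> 0 \<longrightarrow> x \<in> W \<or> inverse x \<in> W)"

definition Zar :: "'k::field set \<Rightarrow> 'k set set" where
  "Zar D = {W. valuation_ring W \<and> D \<subseteq> W \<and> W \<subseteq> quotient_field D \<and>
                quotient_field W = quotient_field D}"

definition Zar_topology :: "'k::field set \<Rightarrow> 'k set topology" where
  "Zar_topology D = topology_generated_by {{W \<in> Zar D. x \<in> W} | x. x \<in> quotient_field D}"

text \<open>The generated topologies really live on the whole spaces, since \<open>1\<close> is a possible index.\<close>

lemma topspace_Zar_topology:
  assumes "is_subring D"
  shows "topspace (Zar_topology D) = Zar D"
proof -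
  have "1 \<in> quotient_field D"
    using assms unfolding quotient_field_def is_subring_def
    by (intro CollectI exI[of _ 1]) simp
  moreover have "1 \<in> W" if "W \<in> Zar D" for W
    using that by (simp add: Zar_def valuation_ring_def is_subring_def)
  ultimately show ?thesis
    unfolding Zar_topology_def by (auto simp: Union_eq)
qed

lemma topspace_Zar_h_topology:
  assumes "graded_domain \<Gamma> R G"
  shows "topspace (Zar_h_topology \<Gamma> R G) = Zar_h \<Gamma> R G"
proof -
  interpret graded_domain \<Gamma> R G by fact
  have "(1::'b) \<in> sum_family \<Gamma> G"
    using subring direct_sum by (simp add: is_subring_def is_direct_sum_def)
  then obtain F x where F: "F \<subseteq> \<Gamma>" "\<forall>i\<in>F. x i \<in> G i" "(1::'b) = (\<Sum>i\<in>F. x i)"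
    unfolding sum_family_def by blast
  have "\<exists>i\<in>F. x i \<noteq> 0"
  proof (rule ccontr)
    assume "\<not> ?thesis"
    then have "(\<Sum>i\<in>F. x i) = 0" by (intro sum.neutral) blast
    with F(3) show False by simp
  qed
  then obtain i where i: "i \<in> \<Gamma>" "x i \<in> G i" "x i \<noteq> 0" using F by blast
  then have "1 \<in> hom_localization_part \<Gamma> G 0"
    unfolding hom_localization_part_def
    by (intro CollectI exI[of _ "x i"] exI[of _ i]) simp
  moreover have "0 \<in> quotient_group \<Gamma>"
    using i(1) unfolding quotient_group_def by (intro CollectI exI[of _ i]) simp
  ultimately have "1 \<in> hom_localization_homogeneous \<Gamma> G"
    unfolding hom_localization_homogeneous_def by blast
  moreover have "1 \<in> V" if "V \<in> Zar_h \<Gamma> R G" for V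
    using that
    by (simp add: Zar_h_def gr_valuation_overring_def homogeneous_overring_def is_subring_def)
  ultimately show ?thesis
    unfolding Zar_h_topology_def by (auto simp: Union_eq)
qed

definition b_operation :: "'k::field set \<Rightarrow> 'k set \<Rightarrow> 'k set" where
  "b_operation R E = (\<Inter>V\<in>Zar R. span_prod E V)"

text \<open>
  The decomposition of \<open>a\<close> may be padded with zero components, so \<open>0\<close> always counts as a
  component; this does not change the ideal generated.
\<close>

definition homogeneous_components :: "'g set \<Rightarrow> ('g \<Rightarrow> 'k::field set) \<Rightarrow> 'k \<Rightarrow> 'k set" where
  "homogeneous_components \<Gamma> G a =
     {x \<alpha> | F x \<alpha>. finite F \<and> F \<subseteq> \<Gamma> \<and> (\<forall>\<beta>\<in>F. x \<beta> \<in> G \<beta>) \<and> a = (\<Sum>\<beta>\<in>F. x \<beta>) \<and> \<alpha> \<in> F}"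

definition content_ideal ::
  "'g set \<Rightarrow> 'k::field set \<Rightarrow> ('g \<Rightarrow> 'k set) \<Rightarrow> 'k \<Rightarrow> 'k set" where
  "content_ideal \<Gamma> R G a = span_prod (homogeneous_components \<Gamma> G a) R"

definition poly_content_ideal ::
  "'g set \<Rightarrow> 'k::field set \<Rightarrow> ('g \<Rightarrow> 'k set) \<Rightarrow> 'k poly \<Rightarrow> 'k set" where
  "poly_content_ideal \<Gamma> R G f = sum_family {..degree f} (\<lambda>i. content_ideal \<Gamma> R G (coeff f i))"

definition polys_over :: "'k::field set \<Rightarrow> 'k poly set" where
  "polys_over R = {f. \<forall>i. coeff f i \<in> R}"

text \<open>The field \<open>K(X)\<close> is the type \<open>'k poly fract\<close>.\<close>

definition Kr_h :: "'g set \<Rightarrow> 'k::field set \<Rightarrow> ('g \<Rightarrow> 'k set) \<Rightarrow> 'k poly fract set" where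
  "Kr_h \<Gamma> R G =
     {Fract f g | f g. f \<in> polys_over R \<and> g \<in> polys_over R \<and> g \<noteq> 0 \<and>
        (\<exists>h\<in>polys_over R. h \<noteq> 0 \<and>
           span_prod (poly_content_ideal \<Gamma> R G f) (poly_content_ideal \<Gamma> R G h)
             \<subseteq> b_operation R
                  (span_prod (poly_content_ideal \<Gamma> R G g) (poly_content_ideal \<Gamma> R G h)))}"

text \<open>
  An element \<open>x\<close> of \<open>K\<close> is identified with the constant rational function \<open>to_fract [:x:]\<close>, so the
  family below is \<open>W \<inter> (R\<^sub>H)\<^sub>\<alpha>\<close>.
\<close>

definition Zar_to_Zar_h ::
  "'g::ab_group_add set \<Rightarrow> ('g \<Rightarrow> 'k::field set) \<Rightarrow> 'k poly fract set \<Rightarrow> 'k set" where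
  "Zar_to_Zar_h \<Gamma> G W =
     sum_family (quotient_group \<Gamma>)
       (\<lambda>\<alpha>. {x \<in> hom_localization_part \<Gamma> G \<alpha>. to_fract [:x:] \<in> W})"

end

theory Submission
  imports Defs "HOL-Library.Product_Plus"
begin

text \<open>
  A valuation ring \<open>W\<close> of \<open>K(X)\<close> over the Kronecker function ring is determined by the values
  of homogeneous elements: if \<open>c\<close> is a homogeneous component of a coefficient of \<open>g \<in> R[X]\<close>,
  then \<open>\<A>\<^sub>c \<subseteq> \<A>\<^sub>g\<close>, so \<open>c / g\<close> lies in the Kronecker function ring, and therefore the value
  of \<open>g\<close> is the minimum of the values of all its components. Conversely, for a gr-valuation
  overring \<open>V\<close> the minimum of the values of the components is multiplicative by Gauss's
  lemma (for the grading of \<open>R[X]\<close> by \<open>\<nat> \<times> \<Gamma>\<close>, with \<open>\<Gamma>\<close> orderable as it is torsionless) and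
  defines a valuation ring of \<open>K(X)\<close>, which is \<open>V\<^bsub>M\<^esub>(X)\<close> for the homogeneous maximal ideal \<open>M\<close>
  of \<open>V\<close>. Hence \<open>f / g \<in> W\<close> iff some component \<open>c\<close> of \<open>g\<close> satisfies \<open>a / c \<in> W\<close> for the finitely
  many components \<open>a\<close> of \<open>f\<close> and \<open>g\<close>, a condition open in the topology of gr-valuation overrings.
\<close>

subsection \<open>Torsionless monoids\<close>

text \<open>Written as in \<open>torsionless_monoid_def\<close>, so that the hypothesis on
  \<open>\<Gamma>\<close> applies to these multiples verbatim.\<close>

abbreviation multiple :: "nat \<Rightarrow> 'g::ab_group_add \<Rightarrow> 'g" where
  "multiple n x \<equiv> (\<Sum>i<n. x)"

lemma multiple_add: "multiple (m + n) x = multiple m x + multiple n x"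
  by (induction m) (auto simp: algebra_simps)

lemma multiple_multiple: "multiple m (multiple n x) = multiple (m * n) x"
  by (induction m) (auto simp: multiple_add algebra_simps)

text \<open>The nonnegative elements of a translation invariant partial order, with
  \<open>x \<le> y\<close> read as \<open>y - x \<in> P\<close>.\<close>

definition pointed_cone :: "'g::ab_group_add set \<Rightarrow> bool" where
  "pointed_cone P \<longleftrightarrow>
     0 \<in> P \<and> (\<forall>x\<in>P. \<forall>y\<in>P. x + y \<in> P) \<and> (\<forall>x\<in>P. - x \<in> P \<longrightarrow> x = 0)"

lemma multiple_in_cone:
  assumes "pointed_cone P" "x \<in> P"
  shows "multiple n x \<in> P"
  using assms by (induction n) (auto simp: pointed_cone_def add.commute)

lemma pointed_cone_Union:
  assumes "C \<noteq> {}" "subset.chain {P. pointed_cone P} C"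
  shows "pointed_cone (\<Union>C)"
proof -
  have cone: "pointed_cone P" if "P \<in> C" for P
    using assms(2) that by (auto simp: subset.chain_def)
  have common: "\<exists>P\<in>C. x \<in> P \<and> y \<in> P" if "x \<in> \<Union>C" "y \<in> \<Union>C" for x y
    using that subset_chain_def assms(2) unfolding subset.chain_def by blast
  show ?thesis
    unfolding pointed_cone_def
  proof (intro conjI ballI impI)
    show "0 \<in> \<Union>C" using assms(1) cone by (auto simp: pointed_cone_def)
  next
    fix x y assume "x \<in> \<Union>C" "y \<in> \<Union>C"
    then obtain P where "P \<in> C" "x \<in> P" "y \<in> P" using common by blast
    then show "x + y \<in> \<Union>C" using cone by (auto simp: pointed_cone_def)
  next
    fix x assume "x \<in> \<Union>C" "- x \<in> \<Union>C"
    then obtain P where "P \<in> C" "x \<in> P" "- x \<in> P" using common by blast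
    then show "x = 0" using cone by (auto simp: pointed_cone_def)
  qed
qed

text \<open>The cone generated by \<open>P\<close> and \<open>x\<close> is
  \<open>P + \<nat> x\<close>. By maximality it cannot be pointed, and the failure is a relation
  \<open>p + q + (n + m) x = 0\<close> with \<open>n + m > 0\<close>, which puts a negative multiple
  of \<open>x\<close> into \<open>P\<close>.\<close>

lemma maximal_cone_absorbs:
  assumes P: "pointed_cone P" and max: "\<And>P'. pointed_cone P' \<Longrightarrow> P \<subseteq> P' \<Longrightarrow> P' = P"
    and x: "x \<notin> P"
  shows "\<exists>n>0. - multiple n x \<in> P"
proof (rule ccontr)
  assume "\<not> ?thesis"
  then have none: "n = 0" if "- multiple n x \<in> P" for n using that by (metis gr0I)
  define P' where "P' = {p + multiple n x | p n. p \<in> P}"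
  have zero: "0 \<in> P" and plus: "\<And>y z. y \<in> P \<Longrightarrow> z \<in> P \<Longrightarrow> y + z \<in> P"
    and pointed: "\<And>y. y \<in> P \<Longrightarrow> - y \<in> P \<Longrightarrow> y = 0"
    using P by (auto simp: pointed_cone_def)
  have "pointed_cone P'"
    unfolding pointed_cone_def
  proof (intro conjI ballI impI)
    show "0 \<in> P'" unfolding P'_def using zero by (intro CollectI exI[of _ 0] exI[of _ "0::nat"]) simp
  next
    fix y z assume "y \<in> P'" "z \<in> P'"
    then obtain p n q m where "p \<in> P" "q \<in> P" "y = p + multiple n x" "z = q + multiple m x"
      unfolding P'_def by blast
    then have "y + z = (p + q) + multiple (n + m) x" "p + q \<in> P"
      using plus by (auto simp only: multiple_add ac_simps)
    then show "y + z \<in> P'" unfolding P'_def by blast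
  next
    fix y assume "y \<in> P'" "- y \<in> P'"
    then obtain p n q m where *: "p \<in> P" "q \<in> P" "y = p + multiple n x" "- y = q + multiple m x"
      unfolding P'_def by blast
    have "multiple (n + m) x + (p + q) = (p + multiple n x) + (q + multiple m x)"
      by (simp only: multiple_add ac_simps)
    also have "\<dots> = y + - y" using *(3,4) by presburger
    finally have "multiple (n + m) x + (p + q) = 0" by simp
    then have "- multiple (n + m) x = p + q" by (rule minus_unique)
    then have "- multiple (n + m) x \<in> P" using plus *(1,2) by simp
    then have "n + m = 0" by (rule none)
    then have "y = p" "- y = q" using *(3,4) by simp_all
    then show "y = 0" using pointed *(1,2) by metis
  qed
  moreover have "P \<subseteq> P'"
  proof
    fix p assume "p \<in> P"
    then show "p \<in> P'" unfolding P'_def by (intro CollectI exI[of _ p] exI[of _ "0::nat"]) simp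
  qed
  moreover have "x \<in> P'"
    unfolding P'_def using zero by (intro CollectI exI[of _ 0] exI[of _ "1::nat"]) simp
  ultimately show False using max x by blast
qed

text \<open>A maximal pointed cone works: for incomparable \<open>\<alpha>\<close>,
  \<open>\<beta>\<close> with difference \<open>x\<close>, negative multiples of both
  \<open>x\<close> and \<open>- x\<close> lie in \<open>P\<close>, hence some positive multiple of
  \<open>x\<close> vanishes, against torsionlessness. Totality is claimed only on
  \<open>\<Gamma>\<close>, because the rest of the ambient group may have torsion.\<close>

lemma torsionless_total_cone:
  fixes \<Gamma> :: "'g::ab_group_add set"
  assumes "torsionless_monoid \<Gamma>"
  obtains P :: "'g set" where "pointed_cone P"
    and "\<And>\<alpha> \<beta>. \<alpha> \<in> \<Gamma> \<Longrightarrow> \<beta> \<in> \<Gamma> \<Longrightarrow> \<alpha> - \<beta> \<in> P \<or> \<beta> - \<alpha> \<in> P"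
proof -
  have "pointed_cone {0::'g}" by (simp add: pointed_cone_def)
  then have "\<exists>M\<in>{P::'g set. pointed_cone P}. \<forall>X\<in>{P. pointed_cone P}. M \<subseteq> X \<longrightarrow> X = M"
    by (intro subset_Zorn_nonempty) (blast, simp add: pointed_cone_Union)
  then obtain P :: "'g set" where P: "pointed_cone P"
    and max: "\<And>P'. pointed_cone P' \<Longrightarrow> P \<subseteq> P' \<Longrightarrow> P' = P"
    by blast
  have "\<alpha> - \<beta> \<in> P \<or> \<beta> - \<alpha> \<in> P" if \<Gamma>: "\<alpha> \<in> \<Gamma>" "\<beta> \<in> \<Gamma>" for \<alpha> \<beta>
  proof (rule ccontr)
    define x where "x = \<alpha> - \<beta>"
    assume "\<not> ?thesis"
    then have "x \<notin> P" "- x \<notin> P" by (auto simp: x_def)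
    from maximal_cone_absorbs[OF P max this(1)] maximal_cone_absorbs[OF P max this(2)]
    obtain n m where nm: "n > 0" "m > 0" "- multiple n x \<in> P" "- multiple m (- x) \<in> P" by blast
    \<comment> \<open>At the common multiple \<open>n * m\<close> both memberships speak about the
      same element up to sign.\<close>
    define y where "y = multiple (n * m) x"
    have "y \<in> P" "- y \<in> P"
      using multiple_in_cone[OF P nm(4), of n] multiple_in_cone[OF P nm(3), of m]
      by (simp_all add: sum_negf multiple_multiple y_def mult.commute)
    then have "y = 0" using P by (auto simp: pointed_cone_def)
    then have "multiple (n * m) \<alpha> = multiple (n * m) \<beta>" by (simp add: x_def y_def sum_subtractf)
    moreover have "n * m > 0" using nm by simp
    ultimately have "\<alpha> = \<beta>" using assms \<Gamma> unfolding torsionless_monoid_def by blast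
    with \<open>x \<notin> P\<close> P show False by (simp add: x_def pointed_cone_def)
  qed
  with P show ?thesis by (rule that)
qed

lemma cone_least_element:
  assumes P: "pointed_cone P" and total: "\<And>\<alpha> \<beta>. \<alpha> \<in> \<Gamma> \<Longrightarrow> \<beta> \<in> \<Gamma> \<Longrightarrow> \<alpha> - \<beta> \<in> P \<or> \<beta> - \<alpha> \<in> P"
    and A: "finite A" "A \<noteq> {}" "A \<subseteq> \<Gamma>"
  shows "\<exists>a\<in>A. \<forall>a'\<in>A. a' - a \<in> P"
  using A
proof (induction rule: finite_ne_induct)
  case (singleton x)
  then show ?case using P by (simp add: pointed_cone_def)
next
  case (insert x F)
  then obtain a where a: "a \<in> F" "\<forall>a'\<in>F. a' - a \<in> P" by blast
  have trans: "p - r \<in> P" if "p - q \<in> P" "q - r \<in> P" for p q r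
  proof -
    have "(p - q) + (q - r) \<in> P" using that P unfolding pointed_cone_def by blast
    then show ?thesis by simp
  qed
  have "x - x \<in> P" using P by (simp add: pointed_cone_def)
  have "x - a \<in> P \<or> a - x \<in> P" using total insert.prems a(1) by blast
  then show ?case using a trans \<open>x - x \<in> P\<close> by (metis insert_iff)
qed

text \<open>The least elements \<open>a\<close> and \<open>b\<close> work: in
  \<open>a' + b' = a + b\<close> both \<open>a' - a\<close> and \<open>b' - b\<close> are
  nonnegative and they are opposite, so both vanish. This is the combinatorial core of Gauss's
  lemma.\<close>

lemma torsionless_unique_sum:
  fixes A B :: "'g::ab_group_add set"
  assumes \<Gamma>: "torsionless_monoid \<Gamma>"
    and A: "finite A" "A \<noteq> {}" "A \<subseteq> \<Gamma>" and B: "finite B" "B \<noteq> {}" "B \<subseteq> \<Gamma>"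
  shows "\<exists>a\<in>A. \<exists>b\<in>B. \<forall>a'\<in>A. \<forall>b'\<in>B. a' + b' = a + b \<longrightarrow> a' = a \<and> b' = b"
proof -
  obtain P :: "'g set" where P: "pointed_cone P"
    and total: "\<And>\<alpha> \<beta>. \<alpha> \<in> \<Gamma> \<Longrightarrow> \<beta> \<in> \<Gamma> \<Longrightarrow> \<alpha> - \<beta> \<in> P \<or> \<beta> - \<alpha> \<in> P"
    using torsionless_total_cone[OF \<Gamma>] by blast
  obtain a b where a: "a \<in> A" "\<forall>a'\<in>A. a' - a \<in> P" and b: "b \<in> B" "\<forall>b'\<in>B. b' - b \<in> P"
    using cone_least_element[OF P total A] cone_least_element[OF P total B] by blast
  have "a' = a \<and> b' = b" if "a' \<in> A" "b' \<in> B" "a' + b' = a + b" for a' b'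
  proof -
    have "b' - b = - (a' - a)" using that(3) by (simp add: algebra_simps)
    then have "a' - a = 0" using a b that P unfolding pointed_cone_def by metis
    then show ?thesis using that(3) by simp
  qed
  then show ?thesis using a b by blast
qed

text \<open>The type \<open>nat \<times> 'g\<close> is not a group, so the previous lemma does not
  apply directly. Minimality fixes the first coordinates, and the previous lemma decides among the
  second ones.\<close>

lemma torsionless_unique_sum_nat_times:
  fixes A B :: "(nat \<times> 'g::ab_group_add) set"
  assumes \<Gamma>: "torsionless_monoid \<Gamma>"
    and A: "finite A" "A \<noteq> {}" "A \<subseteq> UNIV \<times> \<Gamma>" and B: "finite B" "B \<noteq> {}" "B \<subseteq> UNIV \<times> \<Gamma>"
  shows "\<exists>a\<in>A. \<exists>b\<in>B. \<forall>a'\<in>A. \<forall>b'\<in>B. a' + b' = a + b \<longrightarrow> a' = a \<and> b' = b"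
proof -
  define i j where "i = Min (fst ` A)" and "j = Min (fst ` B)"
  have i: "i \<in> fst ` A" "\<And>a. a \<in> A \<Longrightarrow> i \<le> fst a" and j: "j \<in> fst ` B" "\<And>b. b \<in> B \<Longrightarrow> j \<le> fst b"
    using A B by (auto simp: i_def j_def intro!: Min_in)
  define A' B' where "A' = {\<alpha>. (i, \<alpha>) \<in> A}" and "B' = {\<alpha>. (j, \<alpha>) \<in> B}"
  have "A' \<subseteq> snd ` A" "B' \<subseteq> snd ` B" by (force simp: A'_def B'_def)+
  then have fin: "finite A'" "finite B'" using A B by (auto intro: finite_subset)
  have ne: "A' \<noteq> {}" "B' \<noteq> {}" using i j by (force simp: A'_def B'_def)+
  have sub: "A' \<subseteq> \<Gamma>" "B' \<subseteq> \<Gamma>" using A B by (auto simp: A'_def B'_def)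
  obtain \<alpha> \<beta> where \<alpha>: "\<alpha> \<in> A'" and \<beta>: "\<beta> \<in> B'"
    and uniq: "\<And>\<alpha>' \<beta>'. \<alpha>' \<in> A' \<Longrightarrow> \<beta>' \<in> B' \<Longrightarrow> \<alpha>' + \<beta>' = \<alpha> + \<beta> \<Longrightarrow> \<alpha>' = \<alpha> \<and> \<beta>' = \<beta>"
    using torsionless_unique_sum[OF \<Gamma> fin(1) ne(1) sub(1) fin(2) ne(2) sub(2)]
    by (elim bexE) blast
  have "a' = (i, \<alpha>) \<and> b' = (j, \<beta>)"
    if ab: "a' \<in> A" "b' \<in> B" "a' + b' = (i, \<alpha>) + (j, \<beta>)" for a' b'
  proof -
    have "fst a' + fst b' = i + j" "snd a' + snd b' = \<alpha> + \<beta>" using ab(3) by (simp_all add: prod_eq_iff)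
    moreover have "i \<le> fst a'" "j \<le> fst b'" using i j ab by auto
    ultimately have "fst a' = i" "fst b' = j" by linarith+
    then have "snd a' \<in> A'" "snd b' \<in> B'" using ab by (auto simp: A'_def B'_def)
    then have "snd a' = \<alpha> \<and> snd b' = \<beta>" using uniq \<open>snd a' + snd b' = _\<close> by blast
    with \<open>fst a' = i\<close> \<open>fst b' = j\<close> show ?thesis by (simp add: prod_eq_iff)
  qed
  then show ?thesis using \<alpha> \<beta> unfolding A'_def B'_def by blast
qed

subsection \<open>Homogeneous components\<close>

lemma is_subringD:
  assumes "is_subring A"
  shows subring_zero: "0 \<in> A" and subring_one: "1 \<in> A"
    and subring_add: "x \<in> A \<Longrightarrow> y \<in> A \<Longrightarrow> x + y \<in> A"
    and subring_diff: "x \<in> A \<Longrightarrow> y \<in> A \<Longrightarrow> x - y \<in> A"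
    and subring_mult: "x \<in> A \<Longrightarrow> y \<in> A \<Longrightarrow> x * y \<in> A"
  using assms by (auto simp: is_subring_def)

lemma subring_sum:
  assumes "is_subring A" "\<And>i. i \<in> I \<Longrightarrow> x i \<in> A"
  shows "(\<Sum>i\<in>I. x i) \<in> A"
  using assms(2) by (induction I rule: infinite_finite_induct)
    (auto intro: subring_zero subring_add assms(1))

lemma is_add_subgroupD:
  assumes "is_add_subgroup A"
  shows add_subgroup_zero: "0 \<in> A"
    and add_subgroup_diff: "x \<in> A \<Longrightarrow> y \<in> A \<Longrightarrow> x - y \<in> A"
    and add_subgroup_add: "x \<in> A \<Longrightarrow> y \<in> A \<Longrightarrow> x + y \<in> A"
proof -
  show zero: "0 \<in> A" using assms by (simp add: is_add_subgroup_def)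
  show diff: "x - y \<in> A" if "x \<in> A" "y \<in> A" for x y
    using that assms by (simp add: is_add_subgroup_def)
  show "x + y \<in> A" if "x \<in> A" "y \<in> A"
    using diff[OF that(1) diff[OF zero that(2)]] by simp
qed

lemma add_subgroup_sum:
  assumes "is_add_subgroup A" "\<And>i. i \<in> I \<Longrightarrow> x i \<in> A"
  shows "(\<Sum>i\<in>I. x i) \<in> A"
  using assms(2) by (induction I rule: infinite_finite_induct)
    (auto intro: add_subgroup_zero add_subgroup_add assms(1))

lemma is_subring_polys_over:
  assumes "is_subring R" "f \<in> polys_over R" "g \<in> polys_over R"
  shows polys_over_add: "f + g \<in> polys_over R" and polys_over_mult: "f * g \<in> polys_over R"
    and polys_over_diff: "f - g \<in> polys_over R"
  using assms
  by (auto simp: polys_over_def coeff_mult intro!: subring_add subring_diff subring_sum subring_mult)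

lemma monom_in_polys_over:
  assumes "is_subring R" "x \<in> R"
  shows "monom x n \<in> polys_over R"
  using assms by (auto simp: polys_over_def coeff_monom intro: subring_zero)

lemma polys_over_sum:
  assumes "is_subring R" "\<And>i. i \<in> I \<Longrightarrow> x i \<in> polys_over R"
  shows "(\<Sum>i\<in>I. x i) \<in> polys_over R"
  using assms by (auto simp: polys_over_def coeff_sum intro!: subring_sum)

context graded_domain
begin

text \<open>\<open>G\<close> is arbitrary outside \<open>\<Gamma>\<close>; replacing it there by
  \<open>{0}\<close> frees closure rules such as \<open>part_mult\<close> from membership conditions
  on degrees.\<close>

definition part :: "'g \<Rightarrow> 'k set" where
  "part \<alpha> = (if \<alpha> \<in> \<Gamma> then G \<alpha> else {0})"

text \<open>A total function of finite support, instead of a family on a chosen finite set, makes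
  decompositions unique; \<open>component\<close> relies on this.\<close>

definition is_decomposition :: "'k \<Rightarrow> ('g \<Rightarrow> 'k) \<Rightarrow> bool" where
  "is_decomposition a c \<longleftrightarrow>
     finite {\<alpha>. c \<alpha> \<noteq> 0} \<and> (\<forall>\<alpha>. c \<alpha> \<in> part \<alpha>) \<and> a = (\<Sum>\<alpha> | c \<alpha> \<noteq> 0. c \<alpha>)"

definition component :: "'k \<Rightarrow> 'g \<Rightarrow> 'k" where
  "component a = (SOME c. is_decomposition a c)"

lemma monoid_add: "\<alpha> \<in> \<Gamma> \<Longrightarrow> \<beta> \<in> \<Gamma> \<Longrightarrow> \<alpha> + \<beta> \<in> \<Gamma>"
  and monoid_zero: "0 \<in> \<Gamma>"
  using monoid by (auto simp: torsionless_monoid_def)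

lemma subgroup_part: "is_add_subgroup (part \<alpha>)"
  using parts by (auto simp: part_def is_add_subgroup_def)

lemma zero_part [simp]: "0 \<in> part \<alpha>"
  using subgroup_part add_subgroup_zero by blast

lemma part_mult: "a \<in> part \<alpha> \<Longrightarrow> b \<in> part \<beta> \<Longrightarrow> a * b \<in> part (\<alpha> + \<beta>)"
  using mult monoid_add zero_part[of "\<alpha> + \<beta>"]
  by (cases "a = 0 \<or> b = 0") (auto simp: part_def split: if_splits)

lemma degree_in_monoid: "x \<in> part \<alpha> \<Longrightarrow> x \<noteq> 0 \<Longrightarrow> \<alpha> \<in> \<Gamma>"
  by (auto simp: part_def split: if_splits)

lemma nonzero_homogeneous_iff: "x \<in> nonzero_homogeneous \<Gamma> G \<longleftrightarrow> x \<noteq> 0 \<and> (\<exists>\<alpha>. x \<in> part \<alpha>)"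
  unfolding nonzero_homogeneous_def by (auto simp: part_def split: if_splits)

lemma R_eq_sum_family: "R = sum_family \<Gamma> G"
  and independent: "independent_family \<Gamma> G"
  using direct_sum by (simp_all add: is_direct_sum_def)

lemma part_subset: "part \<alpha> \<subseteq> R"
proof
  fix x assume x: "x \<in> part \<alpha>"
  show "x \<in> R"
  proof (cases "x = 0")
    case False
    then show ?thesis
      using x degree_in_monoid[OF x False] unfolding R_eq_sum_family sum_family_def
      by (intro CollectI exI[of _ "{\<alpha>}"] exI[of _ "\<lambda>_. x"]) (auto simp: part_def)
  qed (simp add: subring_zero subring)
qed

text \<open>Indices outside \<open>\<Gamma>\<close> carry only zero, so dropping the zero terms
  leaves a family to which \<open>independent\<close> applies.\<close>

lemma sum_part_eq_zeroD:
  assumes "finite F" "\<And>\<alpha>. \<alpha> \<in> F \<Longrightarrow> x \<alpha> \<in> part \<alpha>" "(\<Sum>\<alpha>\<in>F. x \<alpha>) = 0" "\<alpha> \<in> F"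
  shows "x \<alpha> = 0"
proof (rule ccontr)
  assume nz: "x \<alpha> \<noteq> 0"
  define F' where "F' = {\<beta>\<in>F. x \<beta> \<noteq> 0}"
  have "(\<Sum>\<alpha>\<in>F'. x \<alpha>) = (\<Sum>\<alpha>\<in>F. x \<alpha>)"
    using assms(1) by (intro sum.mono_neutral_left) (auto simp: F'_def)
  moreover have "F' \<subseteq> \<Gamma>" "\<forall>\<beta>\<in>F'. x \<beta> \<in> G \<beta>" "finite F'"
    using assms(1,2) degree_in_monoid by (auto simp: F'_def) (metis part_def degree_in_monoid)
  ultimately have "\<forall>\<beta>\<in>F'. x \<beta> = 0"
    using independent assms(3) unfolding independent_family_def by metis
  then show False using nz assms(4) by (auto simp: F'_def)
qed

lemma is_decompositionI:
  assumes "finite F" "\<And>\<alpha>. c \<alpha> \<in> part \<alpha>" "\<And>\<alpha>. \<alpha> \<notin> F \<Longrightarrow> c \<alpha> = 0" "a = (\<Sum>\<alpha>\<in>F. c \<alpha>)"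
  shows "is_decomposition a c"
  unfolding is_decomposition_def
proof (intro conjI allI)
  have sub: "{\<alpha>. c \<alpha> \<noteq> 0} \<subseteq> F" using assms(3) by blast
  then show "finite {\<alpha>. c \<alpha> \<noteq> 0}" using assms(1) finite_subset by blast
  show "a = (\<Sum>\<alpha> | c \<alpha> \<noteq> 0. c \<alpha>)"
    unfolding assms(4) using sub assms(1) by (intro sum.mono_neutral_right) auto
qed (rule assms(2))

lemma is_decomposition_sum:
  assumes "is_decomposition a c" "finite F" "{\<alpha>. c \<alpha> \<noteq> 0} \<subseteq> F"
  shows "(\<Sum>\<alpha>\<in>F. c \<alpha>) = a"
proof -
  have "(\<Sum>\<alpha>\<in>F. c \<alpha>) = (\<Sum>\<alpha> | c \<alpha> \<noteq> 0. c \<alpha>)"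
    using assms(2,3) by (intro sum.mono_neutral_right) auto
  then show ?thesis using assms(1) by (simp add: is_decomposition_def)
qed

lemma is_decomposition_unique:
  assumes c: "is_decomposition a c" and d: "is_decomposition a d"
  shows "c = d"
proof
  fix \<alpha>
  define F where "F = insert \<alpha> ({\<alpha>. c \<alpha> \<noteq> 0} \<union> {\<alpha>. d \<alpha> \<noteq> 0})"
  have F: "finite F" using c d by (simp add: F_def is_decomposition_def)
  have "(\<Sum>\<alpha>\<in>F. c \<alpha>) = a" "(\<Sum>\<alpha>\<in>F. d \<alpha>) = a"
    using is_decomposition_sum[OF c F] is_decomposition_sum[OF d F] by (auto simp: F_def)
  then have "(\<Sum>\<alpha>\<in>F. c \<alpha> - d \<alpha>) = 0" by (simp add: sum_subtractf)
  moreover have "c \<alpha> - d \<alpha> \<in> part \<alpha>" for \<alpha>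
    using c d add_subgroup_diff[OF subgroup_part] by (auto simp: is_decomposition_def)
  ultimately have "c \<alpha> - d \<alpha> = 0"
    using sum_part_eq_zeroD[OF F, of "\<lambda>\<alpha>. c \<alpha> - d \<alpha>" \<alpha>] by (simp add: F_def)
  then show "c \<alpha> = d \<alpha>" by simp
qed

lemma is_decomposition_iff:
  assumes "is_decomposition a c"
  shows "component a = c"
  unfolding component_def using assms is_decomposition_unique by blast

lemma is_decomposition_component:
  assumes "a \<in> R"
  shows "is_decomposition a (component a)"
proof -
  obtain F x where F: "finite F" "F \<subseteq> \<Gamma>" "\<forall>\<alpha>\<in>F. x \<alpha> \<in> G \<alpha>" "a = (\<Sum>\<alpha>\<in>F. x \<alpha>)"
    using assms unfolding R_eq_sum_family sum_family_def by blast
  then have "is_decomposition a (\<lambda>\<alpha>. if \<alpha> \<in> F then x \<alpha> else 0)"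
    by (intro is_decompositionI[of F]) (auto simp: part_def intro: add_subgroup_zero parts)
  then show ?thesis using is_decomposition_iff by simp
qed

lemma component_in_part: "a \<in> R \<Longrightarrow> component a \<alpha> \<in> part \<alpha>"
  and finite_components: "a \<in> R \<Longrightarrow> finite {\<alpha>. component a \<alpha> \<noteq> 0}"
  and sum_components: "a \<in> R \<Longrightarrow> (\<Sum>\<alpha> | component a \<alpha> \<noteq> 0. component a \<alpha>) = a"
  using is_decomposition_component by (auto simp: is_decomposition_def)

lemma component_part:
  assumes "x \<in> part \<alpha>"
  shows "component x \<beta> = (if \<beta> = \<alpha> then x else 0)"
proof -
  have "is_decomposition x (\<lambda>\<beta>. if \<beta> = \<alpha> then x else 0)"
    using assms by (intro is_decompositionI[of "{\<alpha>}"]) auto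
  then show ?thesis using is_decomposition_iff by simp
qed

lemma component_zero [simp]: "component 0 \<alpha> = 0"
  using component_part[OF zero_part] by simp

lemma component_add:
  assumes "a \<in> R" "b \<in> R"
  shows "component (a + b) \<alpha> = component a \<alpha> + component b \<alpha>"
proof -
  define F where "F = {\<alpha>. component a \<alpha> \<noteq> 0} \<union> {\<alpha>. component b \<alpha> \<noteq> 0}"
  have F: "finite F" using assms finite_components by (simp add: F_def)
  have "(\<Sum>\<alpha>\<in>F. component a \<alpha>) = a" "(\<Sum>\<alpha>\<in>F. component b \<alpha>) = b"
    using assms F by (auto simp: F_def intro!: is_decomposition_sum is_decomposition_component)
  then have "a + b = (\<Sum>\<alpha>\<in>F. component a \<alpha> + component b \<alpha>)"
    using assms by (simp add: sum.distrib)
  then have "is_decomposition (a + b) (\<lambda>\<alpha>. component a \<alpha> + component b \<alpha>)"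
    using F assms by (intro is_decompositionI[of F])
      (auto simp: F_def intro: add_subgroup_add[OF subgroup_part] component_in_part)
  then show ?thesis using is_decomposition_iff by simp
qed

text \<open>The axioms of the grading do not state this. A nonzero component \<open>b\<close> of
  \<open>1\<close>, of degree \<open>\<beta>\<close>, satisfies \<open>b = b * 1\<close>; expanding
  \<open>1\<close> and comparing with the trivial decomposition of \<open>b\<close> in degree
  \<open>\<beta>\<close> gives \<open>b * component 1 0 = b\<close>.\<close>

lemma one_in_part_zero: "1 \<in> part 0"
proof -
  have R1: "1 \<in> R" using subring subring_one by blast
  obtain \<beta> where \<beta>: "component 1 \<beta> \<noteq> 0"
    using sum_components[OF R1] by (metis (mono_tags, lifting) sum.neutral zero_neq_one mem_Collect_eq)
  define b where "b = component 1 \<beta>"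
  have b: "b \<in> part \<beta>" "b \<noteq> 0" using component_in_part[OF R1] \<beta> by (auto simp: b_def)
  \<comment> \<open>The decomposition of \<open>1\<close> multiplied by \<open>b\<close>, hence
    shifted by \<open>\<beta>\<close>.\<close>
  define c where "c = (\<lambda>\<alpha>. b * component 1 (\<alpha> - \<beta>))"
  have "is_decomposition b c"
  proof (intro is_decompositionI[of "(\<lambda>\<alpha>. \<beta> + \<alpha>) ` {\<alpha>. component 1 \<alpha> \<noteq> 0}"])
    show "c \<alpha> \<in> part \<alpha>" for \<alpha>
      using part_mult[OF b(1) component_in_part[OF R1, of "\<alpha> - \<beta>"]] by (simp add: c_def)
    show "c \<alpha> = 0" if "\<alpha> \<notin> (+) \<beta> ` {\<alpha>. component 1 \<alpha> \<noteq> 0}" for \<alpha>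
      using that image_iff[of \<alpha> "(+) \<beta>"] by (force simp: c_def)
    show "b = (\<Sum>\<alpha>\<in>(+) \<beta> ` {\<alpha>. component 1 \<alpha> \<noteq> 0}. c \<alpha>)"
      using sum_components[OF R1] by (simp add: sum.reindex c_def flip: sum_distrib_left)
  qed (use finite_components[OF R1] in simp)
  then have "c \<alpha> = (if \<alpha> = \<beta> then b else 0)" for \<alpha>
    using is_decomposition_iff component_part[OF b(1)] by metis
  from this[of "0 + \<beta>"] have "component 1 0 = 1" using b(2) by (simp add: c_def)
  then show ?thesis using component_in_part[OF R1, of 0] by simp
qed

section \<open>The grading of \<open>R[X]\<close> by \<open>\<nat> \<times> \<Gamma>\<close>\<close>

definition poly_component :: "'k poly \<Rightarrow> nat \<times> 'g \<Rightarrow> 'k" where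
  "poly_component f s = component (coeff f (fst s)) (snd s)"

definition support :: "'k poly \<Rightarrow> (nat \<times> 'g) set" where
  "support f = {s. poly_component f s \<noteq> 0}"

lemma coeff_polys_over: "f \<in> polys_over R \<Longrightarrow> coeff f i \<in> R"
  by (simp add: polys_over_def)

lemma poly_component_in_part: "f \<in> polys_over R \<Longrightarrow> poly_component f s \<in> part (snd s)"
  by (simp add: poly_component_def component_in_part coeff_polys_over)

lemma poly_component_zero [simp]: "poly_component 0 s = 0"
  by (simp add: poly_component_def)

lemma poly_component_monom:
  assumes "x \<in> part \<alpha>"
  shows "poly_component (monom x i) s = (if s = (i, \<alpha>) then x else 0)"
  using component_part[OF assms]
  by (cases s) (auto simp: poly_component_def coeff_monom)

lemma poly_component_add:
  assumes "f \<in> polys_over R" "g \<in> polys_over R"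
  shows "poly_component (f + g) s = poly_component f s + poly_component g s"
  using assms by (simp add: poly_component_def component_add coeff_polys_over)

lemma poly_component_sum:
  assumes "\<And>i. i \<in> I \<Longrightarrow> x i \<in> polys_over R"
  shows "poly_component (\<Sum>i\<in>I. x i) s = (\<Sum>i\<in>I. poly_component (x i) s)"
  using assms
  by (induction I rule: infinite_finite_induct) (simp_all add: poly_component_add polys_over_sum subring)

lemma finite_support:
  assumes "f \<in> polys_over R"
  shows "finite (support f)"
proof -
  have "support f \<subseteq> (SIGMA i:{..degree f}. {\<alpha>. component (coeff f i) \<alpha> \<noteq> 0})"
  proof
    fix s assume s: "s \<in> support f"
    have "fst s \<le> degree f"
    proof (rule ccontr)
      assume "\<not> ?thesis"
      then have "poly_component f s = 0"
        by (simp add: poly_component_def coeff_eq_0)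
      with s show False by (simp add: support_def)
    qed
    then show "s \<in> (SIGMA i:{..degree f}. {\<alpha>. component (coeff f i) \<alpha> \<noteq> 0})"
      using s by (cases s) (simp add: support_def poly_component_def)
  qed
  then show ?thesis
    by (rule finite_subset) (auto intro!: finite_SigmaI finite_components coeff_polys_over assms)
qed

lemma poly_eq_sum_components:
  assumes "f \<in> polys_over R"
  shows "(\<Sum>s\<in>support f. monom (poly_component f s) (fst s)) = f"
proof (rule poly_eqI)
  fix n
  have "coeff (\<Sum>s\<in>support f. monom (poly_component f s) (fst s)) n =
      (\<Sum>s\<in>support f. if fst s = n then poly_component f s else 0)"
    by (simp add: coeff_sum coeff_monom)
  also have "\<dots> = (\<Sum>s\<in>{s\<in>support f. fst s = n}. poly_component f s)"
    using finite_support[OF assms] by (simp add: sum.inter_filter)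
  also have "{s\<in>support f. fst s = n} = Pair n ` {\<alpha>. component (coeff f n) \<alpha> \<noteq> 0}"
    by (auto simp: support_def poly_component_def)
  also have "(\<Sum>s\<in>\<dots>. poly_component f s) = coeff f n"
    using sum_components[OF coeff_polys_over[OF assms], of n]
    by (simp add: sum.reindex inj_on_def poly_component_def)
  finally show "coeff (\<Sum>s\<in>support f. monom (poly_component f s) (fst s)) n = coeff f n" .
qed

lemma support_nonempty:
  assumes "f \<in> polys_over R" "f \<noteq> 0"
  shows "support f \<noteq> {}"
  using poly_eq_sum_components[OF assms(1)] assms(2) by auto

lemma support_subset: "f \<in> polys_over R \<Longrightarrow> support f \<subseteq> UNIV \<times> \<Gamma>"
  using poly_component_in_part degree_in_monoid unfolding support_def by fastforce

text \<open>Both factors are expanded into homogeneous monomials. Each product of two of them lies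
  in a single degree, so taking the component at \<open>u\<close> selects the pairs with sum
  \<open>u\<close>.\<close>

lemma poly_component_mult:
  assumes f: "f \<in> polys_over R" and g: "g \<in> polys_over R"
  shows "poly_component (f * g) u =
    (\<Sum>(s, t)\<in>{p\<in>support f \<times> support g. fst p + snd p = u}. poly_component f s * poly_component g t)"
proof -
  let ?S = "support f \<times> support g"
  let ?m = "\<lambda>(s, t). monom (poly_component f s * poly_component g t) (fst s + fst t)"
  have fg: "f * g = (\<Sum>p\<in>?S. ?m p)"
    by (subst poly_eq_sum_components[OF f, symmetric], subst poly_eq_sum_components[OF g, symmetric])
      (simp add: sum_product sum.cartesian_product mult_monom)
  have part: "poly_component f s * poly_component g t \<in> part (snd s + snd t)" for s t
    using part_mult poly_component_in_part f g by blast
  have R: "?m p \<in> polys_over R" for p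
    using part[of "fst p" "snd p"] part_subset
    by (auto simp: case_prod_beta intro!: monom_in_polys_over subring)
  have "poly_component (f * g) u = (\<Sum>p\<in>?S. poly_component (?m p) u)"
    unfolding fg by (rule poly_component_sum) (rule R)
  also have "\<dots> = (\<Sum>p\<in>?S. if fst p + snd p = u then poly_component f (fst p) * poly_component g (snd p) else 0)"
    by (intro sum.cong) (auto simp: poly_component_monom[OF part] plus_prod_def)
  also have "\<dots> = (\<Sum>p\<in>{p\<in>?S. fst p + snd p = u}. poly_component f (fst p) * poly_component g (snd p))"
    using finite_support f g by (intro sum.inter_filter[symmetric]) auto
  finally show ?thesis by (simp add: case_prod_beta)
qed

end

subsection \<open>Localization at homogeneous elements\<close>

text \<open>\<open>valuation_ring\<close> quantifies over the quotient field of the ring itself.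
  Totality on the whole type makes that field everything, as \<open>x = x / 1\<close> or
  \<open>x = 1 / inverse x\<close>.\<close>

lemma valuation_ringI:
  fixes A :: "'a::field set"
  assumes A: "is_subring A" and total: "\<And>x. x \<noteq> 0 \<Longrightarrow> x \<in> A \<or> inverse x \<in> A"
  shows "valuation_ring A" and "quotient_field A = UNIV"
proof -
  show "valuation_ring A" using assms by (auto simp: valuation_ring_def)
  have "x \<in> quotient_field A" for x
  proof (cases "x \<in> A")
    case True
    then have "x = x / 1 \<and> x \<in> A \<and> 1 \<in> A \<and> (1::'a) \<noteq> 0" using subring_one[OF A] by simp
    then show ?thesis unfolding quotient_field_def by blast
  next
    case False
    then have "x \<noteq> 0" using subring_zero[OF A] by blast
    then have "x = 1 / inverse x \<and> 1 \<in> A \<and> inverse x \<in> A \<and> inverse x \<noteq> 0"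
      using False total[of x] subring_one[OF A] by (simp add: field_simps)
    then show ?thesis unfolding quotient_field_def by blast
  qed
  then show "quotient_field A = UNIV" by blast
qed

lemma span_prod_leastI:
  assumes "is_add_subgroup I" "\<And>a b. a \<in> A \<Longrightarrow> b \<in> B \<Longrightarrow> a * b \<in> I"
  shows "span_prod A B \<subseteq> I"
  using assms by (auto simp: span_prod_def intro!: add_subgroup_sum)

lemma prod_in_span_prod:
  assumes "a \<in> A" "b \<in> B"
  shows "a * b \<in> span_prod A B"
  unfolding span_prod_def using assms
  by (intro CollectI exI[of _ "1::nat"] exI[of _ "\<lambda>_. a"] exI[of _ "\<lambda>_. b"]) simp

lemma span_prod_mono: "A \<subseteq> A' \<Longrightarrow> span_prod A B \<subseteq> span_prod A' B"
  unfolding span_prod_def by blast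

lemma subset_span_prod_ring:
  assumes "is_subring V"
  shows "A \<subseteq> span_prod A V"
proof
  fix a assume "a \<in> A"
  then show "a \<in> span_prod A V" using prod_in_span_prod[of a A 1 V] subring_one[OF assms] by simp
qed

lemma sum_family_leastI:
  assumes "is_add_subgroup J" "\<And>i. i \<in> I \<Longrightarrow> A i \<subseteq> J"
  shows "sum_family I A \<subseteq> J"
  using assms by (auto simp: sum_family_def intro!: add_subgroup_sum)

lemma subset_sum_family: "i \<in> I \<Longrightarrow> A i \<subseteq> sum_family I A"
proof
  fix a assume "i \<in> I" "a \<in> A i"
  then show "a \<in> sum_family I A"
    unfolding sum_family_def by (intro CollectI exI[of _ "{i}"] exI[of _ "\<lambda>_. a"]) simp
qed

lemma zero_in_sum_family: "0 \<in> sum_family I A"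
  unfolding sum_family_def by (intro CollectI exI[of _ "{}"]) simp

lemma is_add_subgroup_sum_family:
  assumes "\<And>i. i \<in> I \<Longrightarrow> is_add_subgroup (A i)"
  shows "is_add_subgroup (sum_family I A)"
  unfolding is_add_subgroup_def
proof (intro conjI ballI)
  fix a b assume "a \<in> sum_family I A" "b \<in> sum_family I A"
  then obtain F x F' y where F: "finite F" "F \<subseteq> I" "\<forall>i\<in>F. x i \<in> A i" "a = (\<Sum>i\<in>F. x i)"
    and F': "finite F'" "F' \<subseteq> I" "\<forall>i\<in>F'. y i \<in> A i" "b = (\<Sum>i\<in>F'. y i)"
    unfolding sum_family_def by blast
  let ?x = "\<lambda>i. (if i \<in> F then x i else 0)" and ?y = "\<lambda>i. (if i \<in> F' then y i else 0)"
  have "a = (\<Sum>i\<in>F \<union> F'. ?x i)" "b = (\<Sum>i\<in>F \<union> F'. ?y i)"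
    using F F' by (auto simp: if_distrib sum.If_cases Int_absorb2 Int_absorb1 intro!: arg_cong2[where f = sum])
  then have "a - b = (\<Sum>i\<in>F \<union> F'. ?x i - ?y i)" by (simp add: sum_subtractf)
  moreover have "?x i - ?y i \<in> A i" if "i \<in> F \<union> F'" for i
    using that F F' assms[of i] by (intro add_subgroup_diff) (auto intro: add_subgroup_zero)
  ultimately show "a - b \<in> sum_family I A"
    unfolding sum_family_def using F F'
    by (intro CollectI exI[of _ "F \<union> F'"] exI[of _ "\<lambda>i. ?x i - ?y i"]) auto
qed (rule zero_in_sum_family)

lemma sum_family_mono:
  assumes "\<And>i. i \<in> I \<Longrightarrow> A i \<subseteq> B i"
  shows "sum_family I A \<subseteq> sum_family I B"
proof
  fix a assume "a \<in> sum_family I A"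
  then obtain F x where "finite F" "F \<subseteq> I" "\<forall>i\<in>F. x i \<in> A i" "a = (\<Sum>i\<in>F. x i)"
    unfolding sum_family_def by blast
  moreover from this have "\<forall>i\<in>F. x i \<in> B i" using assms by blast
  ultimately show "a \<in> sum_family I B" unfolding sum_family_def by blast
qed

text \<open>Needed because \<open>hom_localization_part \<Gamma> G \<alpha>\<close> is empty, rather than zero, when \<open>\<alpha>\<close> has no
  representation as a difference \<open>\<beta> - \<gamma>\<close> with \<open>G \<gamma> \<noteq> {0}\<close>.\<close>

lemma sum_family_insert_zero: "sum_family I (\<lambda>i. insert 0 (A i)) = sum_family I A"
proof
  show "sum_family I (\<lambda>i. insert 0 (A i)) \<subseteq> sum_family I A"
  proof
    fix a assume "a \<in> sum_family I (\<lambda>i. insert 0 (A i))"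
    then obtain F x where F: "finite F" "F \<subseteq> I" "\<forall>i\<in>F. x i \<in> insert 0 (A i)" "a = (\<Sum>i\<in>F. x i)"
      unfolding sum_family_def by blast
    have "a = (\<Sum>i\<in>{i\<in>F. x i \<noteq> 0}. x i)"
      unfolding F(4) using F(1) by (intro sum.mono_neutral_right) auto
    then show "a \<in> sum_family I A"
      unfolding sum_family_def using F
      by (intro CollectI exI[of _ "{i\<in>F. x i \<noteq> 0}"] exI[of _ x]) auto
  qed
qed (auto simp: sum_family_def)

section \<open>The homogeneous parts of \<open>R_H\<close>\<close>

context graded_domain
begin

lemma quotient_group_diff: "\<alpha> \<in> \<Gamma> \<Longrightarrow> \<beta> \<in> \<Gamma> \<Longrightarrow> \<alpha> - \<beta> \<in> quotient_group \<Gamma>"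
  unfolding quotient_group_def by blast

lemma quotient_group_add:
  assumes "\<alpha> \<in> quotient_group \<Gamma>" "\<beta> \<in> quotient_group \<Gamma>"
  shows "\<alpha> + \<beta> \<in> quotient_group \<Gamma>"
proof -
  obtain a b c d where *: "a \<in> \<Gamma>" "b \<in> \<Gamma>" "c \<in> \<Gamma>" "d \<in> \<Gamma>" "\<alpha> = a - b" "\<beta> = c - d"
    using assms unfolding quotient_group_def by blast
  then have "\<alpha> + \<beta> = (a + c) - (b + d)" by simp
  then show ?thesis using * monoid_add quotient_group_diff by metis
qed

lemma localization_partI:
  assumes "a \<in> part \<beta>" "b \<in> part \<gamma>" "b \<noteq> 0" "\<beta> \<in> \<Gamma>"
  shows "a / b \<in> hom_localization_part \<Gamma> G (\<beta> - \<gamma>)"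
  using assms degree_in_monoid[OF assms(2,3)] unfolding hom_localization_part_def
  by (intro CollectI exI[of _ a] exI[of _ b] exI[of _ \<beta>] exI[of _ \<gamma>]) (simp add: part_def)

lemma localization_partE:
  assumes "x \<in> hom_localization_part \<Gamma> G \<alpha>"
  obtains a b \<beta> \<gamma> where "x = a / b" "a \<in> part \<beta>" "b \<in> part \<gamma>" "b \<noteq> 0"
    "\<beta> \<in> \<Gamma>" "\<gamma> \<in> \<Gamma>" "\<beta> - \<gamma> = \<alpha>"
  using assms unfolding hom_localization_part_def part_def by auto

lemma part_subset_localization_part:
  assumes "\<alpha> \<in> \<Gamma>"
  shows "part \<alpha> \<subseteq> hom_localization_part \<Gamma> G \<alpha>"
proof
  fix a assume "a \<in> part \<alpha>"
  from localization_partI[OF this one_in_part_zero _ assms]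
  show "a \<in> hom_localization_part \<Gamma> G \<alpha>" by simp
qed

lemma localization_part_mult:
  assumes "x \<in> hom_localization_part \<Gamma> G \<alpha>" "y \<in> hom_localization_part \<Gamma> G \<beta>"
  shows "x * y \<in> hom_localization_part \<Gamma> G (\<alpha> + \<beta>)"
proof -
  obtain a b \<gamma> \<delta> where x: "x = a / b" "a \<in> part \<gamma>" "b \<in> part \<delta>" "b \<noteq> 0" "\<gamma> \<in> \<Gamma>" "\<gamma> - \<delta> = \<alpha>"
    using assms(1) by (rule localization_partE)
  obtain c d \<zeta> \<eta> where y: "y = c / d" "c \<in> part \<zeta>" "d \<in> part \<eta>" "d \<noteq> 0" "\<zeta> \<in> \<Gamma>" "\<zeta> - \<eta> = \<beta>"
    using assms(2) by (rule localization_partE)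
  have "(a * c) / (b * d) \<in> hom_localization_part \<Gamma> G ((\<gamma> + \<zeta>) - (\<delta> + \<eta>))"
    using x y by (intro localization_partI part_mult monoid_add) auto
  moreover have "(\<gamma> + \<zeta>) - (\<delta> + \<eta>) = \<alpha> + \<beta>" using x y by auto
  ultimately show ?thesis using x y by simp
qed

lemma subgroup_localization_part:
  "is_add_subgroup (insert 0 (hom_localization_part \<Gamma> G \<alpha>))"
proof -
  have neg: "- x \<in> hom_localization_part \<Gamma> G \<alpha>" if x: "x \<in> hom_localization_part \<Gamma> G \<alpha>" for x
  proof -
    obtain a b \<beta> \<gamma> where x: "x = a / b" "a \<in> part \<beta>" "b \<in> part \<gamma>" "b \<noteq> 0" "\<beta> \<in> \<Gamma>" "\<beta> - \<gamma> = \<alpha>"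
      using x by (rule localization_partE)
    have "0 - a \<in> part \<beta>" using x by (intro add_subgroup_diff subgroup_part zero_part)
    then show ?thesis using localization_partI[of "- a"] x by fastforce
  qed
  have diff: "x - y \<in> hom_localization_part \<Gamma> G \<alpha>"
    if xy: "x \<in> hom_localization_part \<Gamma> G \<alpha>" "y \<in> hom_localization_part \<Gamma> G \<alpha>" for x y
  proof -
    obtain a b \<gamma> \<delta> where x: "x = a / b" "a \<in> part \<gamma>" "b \<in> part \<delta>" "b \<noteq> 0" "\<gamma> \<in> \<Gamma>" "\<delta> \<in> \<Gamma>" "\<gamma> - \<delta> = \<alpha>"
      using xy(1) by (rule localization_partE)
    obtain c d \<zeta> \<eta> where y: "y = c / d" "c \<in> part \<zeta>" "d \<in> part \<eta>" "d \<noteq> 0" "\<zeta> \<in> \<Gamma>" "\<eta> \<in> \<Gamma>" "\<zeta> - \<eta> = \<alpha>"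
      using xy(2) by (rule localization_partE)
    have "\<zeta> = \<alpha> + \<eta>" "\<gamma> = \<alpha> + \<delta>" using x(7) y(7) by (simp_all add: algebra_simps)
    \<comment> \<open>Since \<open>x\<close> and \<open>y\<close> have equal degree, the cross
      products \<open>a * d\<close> and \<open>c * b\<close> are homogeneous of the same
      degree.\<close>
    then have "\<zeta> + \<delta> = \<gamma> + \<eta>" by (simp add: ac_simps)
    then have "c * b \<in> part (\<gamma> + \<eta>)" using part_mult[OF y(2) x(3)] by simp
    then have "a * d - c * b \<in> part (\<gamma> + \<eta>)"
      using part_mult[OF x(2) y(3)] by (intro add_subgroup_diff subgroup_part) auto
    then have "(a * d - c * b) / (b * d) \<in> hom_localization_part \<Gamma> G ((\<gamma> + \<eta>) - (\<delta> + \<eta>))"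
      using x y by (intro localization_partI part_mult monoid_add) auto
    moreover have "(a * d - c * b) / (b * d) = x - y" using x(1,4) y(1,4) by (simp add: field_simps)
    moreover have "(\<gamma> + \<eta>) - (\<delta> + \<eta>) = \<alpha>" using x(7) by simp
    ultimately show ?thesis by simp
  qed
  show ?thesis
    using neg diff unfolding is_add_subgroup_def by force
qed

text \<open>Serves to pull linear relations in the localization back to \<open>R\<close>:
  multiplication by \<open>b\<close> shifts all degrees by the same \<open>\<delta>\<close>.\<close>

lemma common_denominator:
  assumes "finite F" "\<And>\<alpha>. \<alpha> \<in> F \<Longrightarrow> x \<alpha> \<in> hom_localization_part \<Gamma> G \<alpha>"
  shows "\<exists>b \<delta>. b \<in> part \<delta> \<and> b \<noteq> 0 \<and> (\<forall>\<alpha>\<in>F. x \<alpha> * b \<in> part (\<alpha> + \<delta>))"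
  using assms
proof (induction F)
  case empty
  then show ?case using one_in_part_zero by (intro exI[of _ 1] exI[of _ 0]) simp
next
  case (insert \<alpha> F)
  then obtain b \<delta> where b: "b \<in> part \<delta>" "b \<noteq> 0" "\<forall>\<alpha>\<in>F. x \<alpha> * b \<in> part (\<alpha> + \<delta>)" by auto
  obtain a d \<beta> \<gamma> where x: "x \<alpha> = a / d" "a \<in> part \<beta>" "d \<in> part \<gamma>" "d \<noteq> 0" "\<beta> - \<gamma> = \<alpha>"
    using insert.prems[of \<alpha>] by (auto elim: localization_partE)
  show ?case
  proof (intro exI[of _ "b * d"] exI[of _ "\<delta> + \<gamma>"] conjI ballI)
    show "x \<alpha>' * (b * d) \<in> part (\<alpha>' + (\<delta> + \<gamma>))" if "\<alpha>' \<in> insert \<alpha> F" for \<alpha>'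
    proof (cases "\<alpha>' = \<alpha>")
      case True
      have "x \<alpha> * (b * d) = a * b" using x(1,4) by simp
      moreover have "\<beta> + \<delta> = \<alpha> + (\<delta> + \<gamma>)" using x(5) by (auto simp: algebra_simps)
      ultimately show ?thesis using part_mult[OF x(2) b(1)] True by metis
    next
      case False
      then have "x \<alpha>' * b \<in> part (\<alpha>' + \<delta>)" using that b(3) by blast
      then have "(x \<alpha>' * b) * d \<in> part ((\<alpha>' + \<delta>) + \<gamma>)" using x(3) by (rule part_mult)
      then show ?thesis by (simp add: ac_simps)
    qed
  qed (use b x part_mult in auto)
qed

lemma independent_localization_parts:
  "independent_family I (hom_localization_part \<Gamma> G)"
  unfolding independent_family_def
proof (intro allI impI ballI, elim conjE)
  fix F x \<alpha>
  assume F: "finite F" "\<forall>\<alpha>\<in>F. x \<alpha> \<in> hom_localization_part \<Gamma> G \<alpha>" "(\<Sum>\<alpha>\<in>F. x \<alpha>) = 0" "\<alpha> \<in> F"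
  obtain b \<delta> where b: "b \<in> part \<delta>" "b \<noteq> 0" "\<forall>\<alpha>\<in>F. x \<alpha> * b \<in> part (\<alpha> + \<delta>)"
    using common_denominator[of F x] F by blast
  \<comment> \<open>The relation multiplied by \<open>b\<close> and reindexed, so that
    \<open>y \<beta>\<close> lies in \<open>part \<beta>\<close> on the shifted index set.\<close>
  define y where "y = (\<lambda>\<beta>. x (\<beta> - \<delta>) * b)"
  have "y (\<alpha> + \<delta>) = 0"
  proof (rule sum_part_eq_zeroD[of "(\<lambda>\<alpha>. \<alpha> + \<delta>) ` F" y])
    have "(\<Sum>\<alpha>\<in>(\<lambda>\<alpha>. \<alpha> + \<delta>) ` F. y \<alpha>) = (\<Sum>\<alpha>\<in>F. x \<alpha> * b)"
      by (simp add: sum.reindex inj_on_def y_def)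
    also have "\<dots> = 0" using F(3) by (simp flip: sum_distrib_right)
    finally show "(\<Sum>\<alpha>\<in>(\<lambda>\<alpha>. \<alpha> + \<delta>) ` F. y \<alpha>) = 0" .
  qed (use F b in \<open>auto simp: y_def\<close>)
  then show "x \<alpha> = 0" using b(2) by (simp add: y_def)
qed

lemma subgroup_hom_localization: "is_add_subgroup (hom_localization \<Gamma> R G)"
  unfolding is_add_subgroup_def
proof (intro conjI ballI)
  show "0 \<in> hom_localization \<Gamma> R G"
    unfolding hom_localization_def using one_in_part_zero subring_zero[OF subring]
    by (intro CollectI exI[of _ 0] exI[of _ 1]) (auto simp: nonzero_homogeneous_iff)
next
  fix x y assume "x \<in> hom_localization \<Gamma> R G" "y \<in> hom_localization \<Gamma> R G"
  then obtain a b c d \<beta> \<delta> where *: "x = a / b" "y = c / d" "a \<in> R" "c \<in> R"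
    "b \<in> part \<beta>" "b \<noteq> 0" "d \<in> part \<delta>" "d \<noteq> 0"
    unfolding hom_localization_def nonzero_homogeneous_iff by blast
  have "a * d - c * b \<in> R"
    using * part_subset subring by (intro subring_diff subring_mult) auto
  moreover have "b * d \<in> nonzero_homogeneous \<Gamma> G"
    using *(6,8) part_mult[OF *(5,7)] unfolding nonzero_homogeneous_iff by auto
  moreover have "x - y = (a * d - c * b) / (b * d)" using * by (simp add: field_simps)
  ultimately show "x - y \<in> hom_localization \<Gamma> R G" unfolding hom_localization_def by blast
qed

lemma localization_part_subset: "hom_localization_part \<Gamma> G \<alpha> \<subseteq> hom_localization \<Gamma> R G"
proof
  fix x assume "x \<in> hom_localization_part \<Gamma> G \<alpha>"
  then obtain a b \<beta> \<gamma> where "x = a / b" "a \<in> part \<beta>" "b \<in> part \<gamma>" "b \<noteq> 0" by (rule localization_partE)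
  then show "x \<in> hom_localization \<Gamma> R G"
    using part_subset unfolding hom_localization_def nonzero_homogeneous_iff by blast
qed

lemma localization_homogeneous_iff:
  "x \<in> hom_localization_homogeneous \<Gamma> G \<longleftrightarrow>
    (\<exists>a b \<beta> \<gamma>. x = a / b \<and> a \<in> part \<beta> \<and> b \<in> part \<gamma> \<and> b \<noteq> 0)"
proof
  assume "x \<in> hom_localization_homogeneous \<Gamma> G"
  then show "\<exists>a b \<beta> \<gamma>. x = a / b \<and> a \<in> part \<beta> \<and> b \<in> part \<gamma> \<and> b \<noteq> 0"
    unfolding hom_localization_homogeneous_def by (blast elim: localization_partE)
next
  assume "\<exists>a b \<beta> \<gamma>. x = a / b \<and> a \<in> part \<beta> \<and> b \<in> part \<gamma> \<and> b \<noteq> 0"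
  then obtain a b \<beta> \<gamma> where *: "x = a / b" "a \<in> part \<beta>" "b \<in> part \<gamma>" "b \<noteq> 0" by blast
  \<comment> \<open>Zero belongs to \<open>part \<beta>\<close> also for \<open>\<beta>\<close>
    outside \<open>\<Gamma>\<close>, so a zero numerator is given degree \<open>0\<close>.\<close>
  define \<beta>' where "\<beta>' = (if a = 0 then 0 else \<beta>)"
  have "a \<in> part \<beta>'" "\<beta>' \<in> \<Gamma>" using * degree_in_monoid monoid_zero by (auto simp: \<beta>'_def)
  then show "x \<in> hom_localization_homogeneous \<Gamma> G"
    unfolding hom_localization_homogeneous_def
    using * localization_partI[of a \<beta>' b \<gamma>] quotient_group_diff[of \<beta>' \<gamma>] degree_in_monoid[of b \<gamma>]
    by auto
qed

text \<open>\<open>C\<close> will be the trace on \<open>K\<close> of a valuation ring of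
  \<open>K(X)\<close>. Its homogeneous elements span a ring because they are closed under products,
  and each of them is itself a summand, so nothing homogeneous is lost in passing from
  \<open>C\<close> to \<open>V\<close>.\<close>

lemma homogeneous_part_in_Zar_h:
  assumes C: "is_subring C" "R \<subseteq> C"
    and total: "\<And>x. x \<in> hom_localization_homogeneous \<Gamma> G \<Longrightarrow> x \<noteq> 0 \<Longrightarrow> x \<in> C \<or> inverse x \<in> C"
  defines "V \<equiv> sum_family (quotient_group \<Gamma>) (\<lambda>\<alpha>. hom_localization_part \<Gamma> G \<alpha> \<inter> C)"
  shows "V \<in> Zar_h \<Gamma> R G"
    and "\<And>x. x \<in> hom_localization_homogeneous \<Gamma> G \<Longrightarrow> x \<in> V \<longleftrightarrow> x \<in> C"
proof -
  let ?Q = "quotient_group \<Gamma>" and ?A = "\<lambda>\<alpha>. hom_localization_part \<Gamma> G \<alpha> \<inter> C"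
  have subC: "is_add_subgroup C" using C by (simp add: is_subring_def is_add_subgroup_def)
  have VC: "V \<subseteq> C" unfolding V_def by (intro sum_family_leastI subC) blast
  have AV: "?A \<alpha> \<subseteq> V" if "\<alpha> \<in> ?Q" for \<alpha> unfolding V_def using that by (rule subset_sum_family)
  have subA: "is_add_subgroup (insert 0 (?A \<alpha>))" for \<alpha>
    using subgroup_localization_part[of \<alpha>] subC unfolding is_add_subgroup_def by auto
  have V: "is_add_subgroup V"
    unfolding V_def by (subst sum_family_insert_zero[symmetric]) (intro is_add_subgroup_sum_family subA)
  have zero: "0 \<in> ?Q" using quotient_group_diff[OF monoid_zero monoid_zero] by simp
  \<comment> \<open>For a fixed factor, the other factors whose product with it lies in
    \<open>V\<close> form an additive subgroup, so only the summands need checking: first with the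
    fixed factor homogeneous, then with an arbitrary one.\<close>
  have mult_sub: "is_add_subgroup {x. x * y \<in> V}" for y
    using V unfolding is_add_subgroup_def by (auto simp: left_diff_distrib)
  have step: "x * y \<in> V" if "y \<in> ?A \<beta>" "\<beta> \<in> ?Q" "x \<in> V" for x y \<beta>
  proof -
    have "?A \<alpha> \<subseteq> {x. x * y \<in> V}" if "\<alpha> \<in> ?Q" for \<alpha>
    proof
      fix z assume "z \<in> ?A \<alpha>"
      then have "z * y \<in> ?A (\<alpha> + \<beta>)"
        using \<open>y \<in> ?A \<beta>\<close> localization_part_mult subring_mult[OF C(1)] by blast
      then show "z \<in> {x. x * y \<in> V}"
        using AV quotient_group_add that \<open>\<beta> \<in> ?Q\<close> by blast
    qed
    then have "V \<subseteq> {x. x * y \<in> V}"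
      using sum_family_leastI[OF mult_sub, of ?Q ?A] by (simp add: V_def)
    then show ?thesis using that by blast
  qed
  have mult: "x * y \<in> V" if "x \<in> V" "y \<in> V" for x y
  proof -
    have "sum_family ?Q ?A \<subseteq> {y. y * x \<in> V}"
      using step \<open>x \<in> V\<close> by (intro sum_family_leastI mult_sub) (auto simp: mult.commute)
    then show ?thesis using \<open>y \<in> V\<close> by (auto simp: V_def mult.commute)
  qed
  have "1 \<in> V"
    using AV[OF zero] part_subset_localization_part[OF monoid_zero] one_in_part_zero subring_one[OF C(1)]
    by blast
  then have ring: "is_subring V"
    using mult add_subgroup_zero[OF V] add_subgroup_add[OF V] add_subgroup_diff[OF V]
    by (auto simp: is_subring_def)
  have RV: "R \<subseteq> V"
    unfolding R_eq_sum_family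
  proof (rule sum_family_leastI[OF V])
    fix \<alpha> assume \<alpha>: "\<alpha> \<in> \<Gamma>"
    have "part \<alpha> \<subseteq> ?A \<alpha>" using part_subset_localization_part[OF \<alpha>] part_subset C(2) by blast
    moreover have "\<alpha> \<in> ?Q" using quotient_group_diff[OF \<alpha> monoid_zero] by simp
    ultimately have "part \<alpha> \<subseteq> V" using AV by (meson order_trans)
    then show "G \<alpha> \<subseteq> V" using \<alpha> by (simp add: part_def)
  qed
  have loc: "V \<subseteq> hom_localization \<Gamma> R G"
    unfolding V_def using localization_part_subset
    by (intro sum_family_leastI subgroup_hom_localization) blast
  have eq: "V \<inter> hom_localization_part \<Gamma> G \<alpha> = ?A \<alpha>" if "\<alpha> \<in> ?Q" for \<alpha>
    using AV[OF that] VC by blast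
  have "V = sum_family ?Q (\<lambda>\<alpha>. V \<inter> hom_localization_part \<Gamma> G \<alpha>)"
  proof
    have "sum_family ?Q ?A \<subseteq> sum_family ?Q (\<lambda>\<alpha>. V \<inter> hom_localization_part \<Gamma> G \<alpha>)"
      using eq by (intro sum_family_mono) blast
    then show "V \<subseteq> sum_family ?Q (\<lambda>\<alpha>. V \<inter> hom_localization_part \<Gamma> G \<alpha>)"
      by (simp add: V_def)
    show "sum_family ?Q (\<lambda>\<alpha>. V \<inter> hom_localization_part \<Gamma> G \<alpha>) \<subseteq> V"
      by (intro sum_family_leastI V) blast
  qed
  moreover have "independent_family ?Q (\<lambda>\<alpha>. V \<inter> hom_localization_part \<Gamma> G \<alpha>)"
    using independent_localization_parts[of ?Q] unfolding independent_family_def by blast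
  ultimately have hom: "homogeneous_overring \<Gamma> R G V"
    using ring RV loc unfolding homogeneous_overring_def is_direct_sum_def by blast
  show iff: "x \<in> V \<longleftrightarrow> x \<in> C" if "x \<in> hom_localization_homogeneous \<Gamma> G" for x
    using that VC AV unfolding hom_localization_homogeneous_def by blast
  have "inverse x \<in> hom_localization_homogeneous \<Gamma> G"
    if "x \<in> hom_localization_homogeneous \<Gamma> G" "x \<noteq> 0" for x
    using that unfolding localization_homogeneous_iff by (metis inverse_divide divide_eq_0_iff)
  then show "V \<in> Zar_h \<Gamma> R G"
    using hom total iff unfolding Zar_h_def gr_valuation_overring_def by blast
qed

end

subsection \<open>Extension of a gr-valuation to \<open>K(X)\<close>\<close>

lemma Fract_add: "b \<noteq> 0 \<Longrightarrow> d \<noteq> 0 \<Longrightarrow> Fract a b + Fract c d = Fract (a * d + c * b) (b * d)"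
  and Fract_diff: "b \<noteq> 0 \<Longrightarrow> d \<noteq> 0 \<Longrightarrow> Fract a b - Fract c d = Fract (a * d - c * b) (b * d)"
  by (simp_all add: Fract_conv_to_fract field_simps)

context graded_domain
begin

lemma polys_over_smult_exists: "\<exists>r\<in>R. r \<noteq> 0 \<and> smult r p \<in> polys_over R"
proof (induction p)
  case 0
  then show ?case using subring_one[OF subring] subring_zero[OF subring]
    by (intro bexI[of _ 1]) (auto simp: polys_over_def)
next
  case (pCons a p)
  then obtain r where r: "r \<in> R" "r \<noteq> 0" "smult r p \<in> polys_over R" by blast
  have "a \<in> quotient_field R" using quotient_field by simp
  then obtain x y where a: "a = x / y" "x \<in> R" "y \<in> R" "y \<noteq> 0" unfolding quotient_field_def by blast
  have "coeff (smult (r * y) (pCons a p)) i \<in> R" for i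
  proof (cases i)
    case 0
    have "coeff (smult (r * y) (pCons a p)) i = r * x" using a 0 by simp
    then show ?thesis using subring_mult[OF subring] r a by simp
  next
    case (Suc j)
    have "coeff (smult (r * y) (pCons a p)) i = y * coeff (smult r p) j" using Suc by simp
    then show ?thesis using subring_mult[OF subring a(3) coeff_polys_over[OF r(3)]] by metis
  qed
  then have "smult (r * y) (pCons a p) \<in> polys_over R" by (simp add: polys_over_def)
  then show ?case using r a subring_mult[OF subring] by (intro bexI[of _ "r * y"]) auto
qed

lemma fract_cases_polys_over:
  obtains f g where "F = Fract f g" "f \<in> polys_over R" "g \<in> polys_over R" "g \<noteq> 0"
proof -
  obtain p q where F: "F = Fract p q" "q \<noteq> 0" by (cases F)
  obtain r where r: "r \<in> R" "r \<noteq> 0" "smult r p \<in> polys_over R"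
    using polys_over_smult_exists by blast
  obtain s where s: "s \<in> R" "s \<noteq> 0" "smult s q \<in> polys_over R"
    using polys_over_smult_exists by blast
  have const: "[:x:] \<in> polys_over R" if "x \<in> R" for x
    using monom_in_polys_over[OF subring that, of 0] by (simp add: monom_0)
  show ?thesis
  proof (rule that)
    show "F = Fract ([:s:] * smult r p) ([:r:] * smult s q)"
      using F r s by (simp add: eq_fract mult.commute mult.left_commute)
    show "[:s:] * smult r p \<in> polys_over R" "[:r:] * smult s q \<in> polys_over R"
      using r s const by (blast intro: polys_over_mult subring)+
  qed (use F r s in simp)
qed

lemma zero_in_polys_over: "0 \<in> polys_over R" and one_in_polys_over: "1 \<in> polys_over R"
  using subring_zero[OF subring] subring_one[OF subring] by (auto simp: polys_over_def coeff_1)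

lemma poly_component_one: "poly_component 1 s = (if s = (0, 0) then 1 else 0)"
  using poly_component_monom[OF one_in_part_zero, of 0 s] by (simp add: monom_0 one_pCons)

lemma poly_component_diff:
  assumes "f \<in> polys_over R" "g \<in> polys_over R"
  shows "poly_component (f - g) s = poly_component f s - poly_component g s"
  using poly_component_add[OF polys_over_diff[OF subring assms] assms(2), of s] by simp

end

locale gr_valuation = graded_domain \<Gamma> R G
  for \<Gamma> :: "'g::ab_group_add set" and R :: "'k::field set" and G :: "'g \<Rightarrow> 'k set" +
  fixes V :: "'k set"
  assumes V: "V \<in> Zar_h \<Gamma> R G"
begin

lemma subring_V: "is_subring V" and R_subset_V: "R \<subseteq> V"
  and V_eq: "V = sum_family (quotient_group \<Gamma>) (\<lambda>\<alpha>. V \<inter> hom_localization_part \<Gamma> G \<alpha>)"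
  using V unfolding Zar_h_def gr_valuation_overring_def homogeneous_overring_def is_direct_sum_def
  by blast+

lemma V_mult: "x \<in> V \<Longrightarrow> y \<in> V \<Longrightarrow> x * y \<in> V"
  by (rule subring_mult[OF subring_V])

lemma ratio_total:
  assumes "x \<in> part \<alpha>" "y \<in> part \<beta>" "x \<noteq> 0" "y \<noteq> 0"
  shows "x / y \<in> V \<or> y / x \<in> V"
proof -
  have "x / y \<in> hom_localization_homogeneous \<Gamma> G"
    using assms unfolding localization_homogeneous_iff by blast
  then have "x / y \<in> V \<or> inverse (x / y) \<in> V"
    using V assms unfolding Zar_h_def gr_valuation_overring_def by auto
  then show ?thesis by simp
qed

text \<open>With the valuation \<open>v\<close> of \<open>V\<close> on homogeneous elements, \<open>below c f\<close> says that every
  homogeneous component of every coefficient has value at least \<open>v c\<close>, and \<open>level c f\<close> that \<open>v c\<close>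
  is the minimum of these values.\<close>

definition below :: "'k \<Rightarrow> 'k poly \<Rightarrow> bool" where
  "below c f \<longleftrightarrow> (\<forall>s. poly_component f s / c \<in> V)"

definition level :: "'k \<Rightarrow> 'k poly \<Rightarrow> bool" where
  "level c f \<longleftrightarrow> c \<noteq> 0 \<and> (\<exists>\<alpha>. c \<in> part \<alpha>) \<and> below c f \<and>
     (\<exists>s. poly_component f s \<noteq> 0 \<and> c / poly_component f s \<in> V)"

lemma belowD: "below c f \<Longrightarrow> poly_component f s / c \<in> V"
  unfolding below_def by blast

lemma V_zero [simp]: "0 \<in> V" and V_one [simp]: "1 \<in> V"
  using subring_zero subring_one subring_V by blast+

lemma below_zero [simp]: "below c 0"
  by (simp add: below_def)

lemma below_add: "f \<in> polys_over R \<Longrightarrow> g \<in> polys_over R \<Longrightarrow> below c f \<Longrightarrow> below c g \<Longrightarrow> below c (f + g)"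
  and below_diff: "f \<in> polys_over R \<Longrightarrow> g \<in> polys_over R \<Longrightarrow> below c f \<Longrightarrow> below c g \<Longrightarrow> below c (f - g)"
  using subring_add[OF subring_V] subring_diff[OF subring_V]
  by (auto simp: below_def poly_component_add poly_component_diff add_divide_distrib diff_divide_distrib)

lemma below_mult:
  assumes "f \<in> polys_over R" "g \<in> polys_over R" "below c f" "below d g"
  shows "below (c * d) (f * g)"
  unfolding below_def
proof
  fix u
  have "(poly_component f s * poly_component g t) / (c * d) \<in> V" for s t
    using V_mult[OF belowD[OF assms(3), of s] belowD[OF assms(4), of t]] by simp
  then show "poly_component (f * g) u / (c * d) \<in> V"
    unfolding poly_component_mult[OF assms(1,2)] sum_divide_distrib
    by (intro subring_sum[OF subring_V]) auto
qed

lemma below_trans: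
  assumes "below c f" "c / d \<in> V" "c \<noteq> 0"
  shows "below d f"
  unfolding below_def
proof
  fix s
  show "poly_component f s / d \<in> V"
    using V_mult[OF belowD[OF assms(1), of s] assms(2)] assms(3) by simp
qed

text \<open>\<open>c / d = (c / a) * (a / d)\<close> for a component \<open>a\<close> of
  \<open>f\<close> at which the minimum is attained.\<close>

lemma level_below:
  assumes "level c f" "below d f"
  shows "c / d \<in> V"
proof -
  obtain s where s: "poly_component f s \<noteq> 0" "c / poly_component f s \<in> V"
    using assms(1) by (auto simp: level_def)
  then show ?thesis
    using V_mult[OF s(2) belowD[OF assms(2), of s]] by simp
qed

lemma level_nonzero: "level c f \<Longrightarrow> c \<noteq> 0" and level_imp_below: "level c f \<Longrightarrow> below c f"
  by (simp_all add: level_def)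

lemma level_total:
  assumes "level c f" "level d g"
  shows "c / d \<in> V \<or> d / c \<in> V"
  using assms ratio_total unfolding level_def by blast

lemma least_component:
  assumes "finite S" "S \<noteq> {}" "\<And>s. s \<in> S \<Longrightarrow> x s \<noteq> 0 \<and> x s \<in> part (\<delta> s)"
  shows "\<exists>t\<in>S. \<forall>s\<in>S. x s / x t \<in> V"
  using assms
proof (induction rule: finite_ne_induct)
  case (insert s S)
  then obtain t where t: "t \<in> S" "\<forall>s\<in>S. x s / x t \<in> V" by auto
  have nz: "x s \<noteq> 0" "x t \<noteq> 0" using insert.prems t by auto
  consider "x s / x t \<in> V" | "x t / x s \<in> V"
    using ratio_total insert.prems t(1) by (metis insertI1 insertI2)
  then show ?case
  proof cases
    case 1
    then show ?thesis using t by blast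
  next
    case 2
    have "x s' / x s \<in> V" if "s' \<in> S" for s'
      using V_mult[of "x s' / x t" "x t / x s"] t(2) that 2 nz by simp
    then show ?thesis using nz by auto
  qed
qed auto

lemma level_component:
  assumes "f \<in> polys_over R" "poly_component f t \<noteq> 0" "below (poly_component f t) f"
  shows "level (poly_component f t) f"
proof -
  have "poly_component f t / poly_component f t \<in> V" using assms(2) by simp
  then show ?thesis
    unfolding level_def using assms poly_component_in_part[OF assms(1), of t] by blast
qed

text \<open>No value group is constructed; the minimum is named by an actual component of
  \<open>f\<close>.\<close>

lemma exists_level_component:
  assumes "f \<in> polys_over R" "f \<noteq> 0"
  obtains t where "poly_component f t \<noteq> 0" "below (poly_component f t) f" "level (poly_component f t) f"
proof -
  obtain t where t: "t \<in> support f" "\<forall>s\<in>support f. poly_component f s / poly_component f t \<in> V"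
    using least_component[OF finite_support[OF assms(1)] support_nonempty[OF assms],
        of "poly_component f" snd] poly_component_in_part[OF assms(1)]
    by (auto simp: support_def)
  have below: "below (poly_component f t) f"
    unfolding below_def
  proof
    fix s
    show "poly_component f s / poly_component f t \<in> V"
      using t(2) by (cases "s \<in> support f") (blast, simp add: support_def)
  qed
  have nz: "poly_component f t \<noteq> 0" using t(1) by (simp add: support_def)
  from nz below level_component[OF assms(1) nz below] show ?thesis by (rule that)
qed

text \<open>In terms of the valuation \<open>v\<close> these are the \<open>z\<close> of degree
  \<open>\<gamma>\<close> with \<open>v z > v e\<close>, so this is the ultrametric inequality in
  strict form. Staying in one degree keeps \<open>x / y\<close> homogeneous, where \<open>V\<close>
  decides between \<open>x / y\<close> and \<open>y / x\<close>.\<close>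

lemma subgroup_large:
  assumes "e \<noteq> 0"
  shows "is_add_subgroup {z \<in> part \<gamma>. z = 0 \<or> e / z \<notin> V}"
  unfolding is_add_subgroup_def
proof (intro conjI ballI)
  fix x y assume x: "x \<in> {z \<in> part \<gamma>. z = 0 \<or> e / z \<notin> V}" and y: "y \<in> {z \<in> part \<gamma>. z = 0 \<or> e / z \<notin> V}"
  have part: "x - y \<in> part \<gamma>" using x y by (intro add_subgroup_diff subgroup_part) auto
  have "e / (x - y) \<notin> V" if nz: "x - y \<noteq> 0"
  proof
    assume *: "e / (x - y) \<in> V"
    \<comment> \<open>If \<open>w / z \<in> V\<close>, then multiplying
      \<open>e / (x - y) \<in> V\<close> by \<open>w / z - 1\<close> or by \<open>1 - w / z\<close>
      stays in \<open>V\<close> and cannot produce \<open>e / z\<close>. The two signs serve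
      \<open>z = y\<close>, \<open>w = x\<close> and \<open>z = x\<close>,
      \<open>w = y\<close>.\<close>
    have bad: "z = 0 \<or> w / z \<notin> V \<or> (w / z - 1) * (e / (x - y)) \<noteq> e / z \<and>
        (1 - w / z) * (e / (x - y)) \<noteq> e / z" if "e / z \<notin> V" for z w
      using that * V_mult subring_diff[OF subring_V] V_one by metis
    have y': "x / y \<notin> V" if "y \<noteq> 0"
    proof -
      have "(x / y - 1) * (e / (x - y)) = e / y" using that nz by (simp add: field_simps)
      then show ?thesis using bad[of y x] that y by auto
    qed
    have x': "y / x \<notin> V" if "x \<noteq> 0"
    proof -
      have "(1 - y / x) * (e / (x - y)) = e / x" using that nz by (simp add: field_simps)
      then show ?thesis using bad[of x y] that x by auto
    qed
    show False
    proof (cases "x = 0 \<or> y = 0")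
      case True
      then show False using x' y' nz by auto
    next
      case False
      then show False using x' y' ratio_total[of x \<gamma> y \<gamma>] x y by auto
    qed
  qed
  then show "x - y \<in> {z \<in> part \<gamma>. z = 0 \<or> e / z \<notin> V}" using part by blast
qed simp

text \<open>Gauss's lemma: among the positions where the minimum is attained in \<open>f\<close> and in \<open>g\<close> there are
  two whose sum arises in no other way, so nothing can cancel the product of the two components.\<close>

lemma level_mult:
  assumes f: "f \<in> polys_over R" and g: "g \<in> polys_over R" and c: "level c f" and d: "level d g"
  shows "level (c * d) (f * g)"
proof -
  define A where "A = {s. poly_component f s \<noteq> 0 \<and> c / poly_component f s \<in> V}"
  define B where "B = {s. poly_component g s \<noteq> 0 \<and> d / poly_component g s \<in> V}"
  have cd: "c \<noteq> 0" "d \<noteq> 0" using c d by (auto simp: level_def)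
  have sub: "A \<subseteq> support f" "B \<subseteq> support g" by (auto simp: A_def B_def support_def)
  then have A: "finite A" "A \<noteq> {}" "A \<subseteq> UNIV \<times> \<Gamma>" and B: "finite B" "B \<noteq> {}" "B \<subseteq> UNIV \<times> \<Gamma>"
    using c d finite_subset[OF sub(1) finite_support[OF f]] finite_subset[OF sub(2) finite_support[OF g]]
      support_subset[OF f] support_subset[OF g]
    unfolding A_def B_def level_def by blast+
  obtain a b where a: "a \<in> A" and b: "b \<in> B"
    and uniq: "\<And>a' b'. a' \<in> A \<Longrightarrow> b' \<in> B \<Longrightarrow> a' + b' = a + b \<Longrightarrow> a' = a \<and> b' = b"
    using torsionless_unique_sum_nat_times[OF monoid A B] by (elim bexE) blast
  define P where "P = {p \<in> support f \<times> support g. fst p + snd p = a + b}"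
  let ?m = "\<lambda>p. poly_component f (fst p) * poly_component g (snd p)"
  \<comment> \<open>The elements in the degree of \<open>a + b\<close> whose value exceeds that of
    \<open>c * d\<close>.\<close>
  let ?I = "{z \<in> part (snd (a + b)). z = 0 \<or> (c * d) / z \<notin> V}"
  have I: "is_add_subgroup ?I" using cd by (intro subgroup_large) simp
  have P: "finite P" "(a, b) \<in> P"
    using finite_support f g a b sub by (auto simp: P_def)
  have part: "?m p \<in> part (snd (a + b))" if "p \<in> P" for p
    using part_mult[OF poly_component_in_part[OF f, of "fst p"] poly_component_in_part[OF g, of "snd p"]] that
    by (auto simp: P_def simp flip: snd_add)
  \<comment> \<open>A remaining pair cannot have the value of \<open>c * d\<close>: both factors
    would then attain their minima, and \<open>uniq\<close> would identify the pair with
    \<open>(a, b)\<close>.\<close>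
  have rest: "?m p \<in> ?I" if p: "p \<in> P - {(a, b)}" for p
  proof -
    let ?x = "poly_component f (fst p)" and ?y = "poly_component g (snd p)"
    have nz: "?x \<noteq> 0" "?y \<noteq> 0" using p by (auto simp: P_def support_def)
    have xy: "?x / c \<in> V" "?y / d \<in> V"
      using belowD[OF level_imp_below[OF c]] belowD[OF level_imp_below[OF d]] by blast+
    have "c * d / (?x * ?y) \<notin> V"
    proof
      assume *: "c * d / (?x * ?y) \<in> V"
      have "c / ?x \<in> V" using V_mult[OF * xy(2)] nz cd by simp
      moreover have "d / ?y \<in> V" using V_mult[OF * xy(1)] nz cd by simp
      ultimately have "fst p \<in> A" "snd p \<in> B" using nz by (auto simp: A_def B_def)
      then show False using uniq[of "fst p" "snd p"] p by (auto simp: P_def)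
    qed
    then show ?thesis using part p by auto
  qed
  let ?z = "poly_component (f * g) (a + b)"
  have "?z = (\<Sum>p\<in>P. ?m p)"
    unfolding poly_component_mult[OF f g] P_def by (simp add: case_prod_beta)
  also have "\<dots> = ?m (a, b) + (\<Sum>p\<in>P - {(a, b)}. ?m p)"
    using P by (rule sum.remove)
  finally have diff: "?z - (\<Sum>p\<in>P - {(a, b)}. ?m p) = ?m (a, b)" by simp
  have sum: "(\<Sum>p\<in>P - {(a, b)}. ?m p) \<in> ?I"
    using rest by (intro add_subgroup_sum[OF I]) blast
  \<comment> \<open>The distinguished term has the value of \<open>c * d\<close> and is therefore
    outside \<open>?I\<close>, while the rest of the sum is inside; so the whole component is
    outside too.\<close>
  have "?m (a, b) \<notin> ?I"
    using a b V_mult[of "c / poly_component f a" "d / poly_component g b"] by (auto simp: A_def B_def)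
  then have "?z \<notin> ?I" using add_subgroup_diff[OF I _ sum, of ?z, unfolded diff] by (rule contrapos_nn)
  moreover have "?z \<in> part (snd (a + b))"
    using poly_component_in_part[OF polys_over_mult[OF subring f g]] .
  ultimately have "?z \<noteq> 0 \<and> (c * d) / ?z \<in> V" by blast
  moreover have "\<exists>\<alpha>. c * d \<in> part \<alpha>" using c d part_mult unfolding level_def by blast
  moreover have "below (c * d) (f * g)"
    using below_mult[OF f g] c d level_imp_below by blast
  moreover have "c * d \<noteq> 0" using cd by simp
  ultimately show ?thesis unfolding level_def by blast
qed

text \<open>The ring of the Gauss extension of the valuation, that is, the fractions with
  \<open>v g \<le> v f\<close>. The minimum for \<open>g\<close> is named by a position
  \<open>t\<close> of \<open>g\<close> itself, so that membership becomes a disjunction over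
  positions, as \<open>openin_extension\<close> needs.\<close>

definition extension :: "'k poly fract set" where
  "extension = {Fract f g | f g t. f \<in> polys_over R \<and> g \<in> polys_over R \<and>
     poly_component g t \<noteq> 0 \<and> below (poly_component g t) g \<and> below (poly_component g t) f}"

text \<open>Gauss's lemma makes \<open>c * d\<close> minimal for \<open>f * g\<close> when
  \<open>c\<close> is minimal for \<open>f\<close>, and the common \<open>d\<close> cancels from
  \<open>(c * d) / (e * d)\<close>.\<close>

lemma below_common_factor:
  assumes R: "f \<in> polys_over R" "g \<in> polys_over R" and g: "level d g" and fg: "below (e * d) (f * g)"
  shows "below e f"
proof (cases "f = 0")
  case False
  then obtain c where c: "level c f" using exists_level_component[OF R(1)] by blast
  have "(c * d) / (e * d) \<in> V" using level_below[OF level_mult[OF R c g] fg] .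
  then have "c / e \<in> V" using level_nonzero[OF g] by simp
  then show ?thesis using below_trans c level_nonzero level_imp_below by blast
qed simp

text \<open>Membership does not depend on the chosen fraction: from \<open>f * g' = f' * g\<close>
  the bound on \<open>f' * g\<close> is a bound on \<open>f * g'\<close>, and the factor
  \<open>g'\<close> is cancelled. Any fraction over \<open>R\<close> can then be tested with any
  \<open>d\<close> of minimal value.\<close>

lemma Fract_in_extension_iff:
  assumes f: "f \<in> polys_over R" and g: "g \<in> polys_over R" and d: "level d g"
  shows "Fract f g \<in> extension \<longleftrightarrow> below d f"
proof
  have g0: "g \<noteq> 0" using d by (auto simp: level_def)
  assume "Fract f g \<in> extension"
  then obtain f' g' t where eq: "Fract f g = Fract f' g'" and R: "f' \<in> polys_over R" "g' \<in> polys_over R"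
    and t: "poly_component g' t \<noteq> 0" "below (poly_component g' t) g'" "below (poly_component g' t) f'"
    unfolding extension_def by blast
  define d' where "d' = poly_component g' t"
  have g'0: "g' \<noteq> 0" using t by auto
  have "level d' g'"
    using t level_component[OF R(2)] by (simp add: d'_def)
  moreover have "f * g' = f' * g" using eq g0 g'0 by (simp add: eq_fract)
  moreover have "below (d' * d) (f' * g)"
    using below_mult[OF R(1) g] t(3) level_imp_below[OF d] by (simp add: d'_def)
  ultimately show "below d f"
    using below_common_factor[OF f R(2), of d' d] by (simp add: mult.commute)
next
  assume *: "below d f"
  obtain t where t: "poly_component g t \<noteq> 0" "below (poly_component g t) g" "level (poly_component g t) g"
    by (rule exists_level_component[OF g]) (use d in \<open>auto simp: level_def\<close>)
  have "below (poly_component g t) f"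
    using below_trans[OF *] level_below[OF d t(2)] level_nonzero[OF d] by blast
  then show "Fract f g \<in> extension" unfolding extension_def using f g t by blast
qed

lemma fract_level_cases:
  obtains f g d where "F = Fract f g" "f \<in> polys_over R" "g \<in> polys_over R" "g \<noteq> 0" "level d g"
  by (metis fract_cases_polys_over exists_level_component)

lemma level_one: "level 1 1"
  unfolding level_def below_def
  using one_in_part_zero by (auto simp: poly_component_one intro!: exI[of _ "(0, 0)"])

lemma subring_extension: "is_subring extension"
  unfolding is_subring_def
proof (intro conjI ballI)
  show "0 \<in> extension" "1 \<in> extension"
    using Fract_in_extension_iff[OF _ one_in_polys_over level_one] level_imp_below[OF level_one]
      zero_in_polys_over one_in_polys_over
    by (simp_all add: Zero_fract_def One_fract_def)
next
  fix x y assume x: "x \<in> extension" and y: "y \<in> extension"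
  obtain f g d where f: "x = Fract f g" "f \<in> polys_over R" "g \<in> polys_over R" "g \<noteq> 0" "level d g"
    by (rule fract_level_cases)
  obtain f' g' d' where f': "y = Fract f' g'" "f' \<in> polys_over R" "g' \<in> polys_over R" "g' \<noteq> 0" "level d' g'"
    by (rule fract_level_cases)
  have b: "below d f" "below d' f'" using x y f f' Fract_in_extension_iff by auto
  have gg': "g * g' \<in> polys_over R" "level (d * d') (g * g')"
    using f f' level_mult polys_over_mult[OF subring] by auto
  have R: "f * g' \<in> polys_over R" "f' * g \<in> polys_over R" "f * f' \<in> polys_over R"
    using f f' polys_over_mult[OF subring] by auto
  have "below (d * d') (f * g')" "below (d * d') (f' * g)" "below (d * d') (f * f')"
    using below_mult[OF f(2) f'(3) b(1) level_imp_below[OF f'(5)]] below_mult[OF f(2) f'(2) b]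
      below_mult[OF f'(2) f(3) b(2) level_imp_below[OF f(5)]]
    by (simp_all add: mult.commute[of d d'])
  then show "x + y \<in> extension" "x - y \<in> extension" "x * y \<in> extension"
    using f f' R gg' Fract_in_extension_iff[OF _ gg'] polys_over_add[OF subring]
      polys_over_diff[OF subring] below_add below_diff
    by (simp_all add: Fract_add Fract_diff)
qed

lemma extension_total:
  assumes "x \<noteq> 0"
  shows "x \<in> extension \<or> inverse x \<in> extension"
proof -
  obtain f g d where f: "x = Fract f g" "f \<in> polys_over R" "g \<in> polys_over R" "g \<noteq> 0" "level d g"
    by (rule fract_level_cases)
  have "f \<noteq> 0" using f(1) assms by (auto simp: fract_collapse)
  then obtain c where c: "level c f" using exists_level_component[OF f(2)] by blast
  consider "c / d \<in> V" | "d / c \<in> V" using level_total[OF c f(5)] by blast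
  then show ?thesis
  proof cases
    case 1
    then have "below d f" using below_trans c level_nonzero level_imp_below by blast
    then show ?thesis using f Fract_in_extension_iff by blast
  next
    case 2
    then have "below c g" using below_trans f(5) level_nonzero level_imp_below by blast
    then show ?thesis using f c Fract_in_extension_iff by simp
  qed
qed

text \<open>With \<open>x\<close> written as a quotient of two homogeneous constants, the
  denominator is its own minimum. This recovers the homogeneous elements of \<open>V\<close> from
  the extension.\<close>

lemma const_in_extension_iff:
  assumes "x \<in> hom_localization_homogeneous \<Gamma> G"
  shows "to_fract [:x:] \<in> extension \<longleftrightarrow> x \<in> V"
proof -
  obtain a b \<beta> \<gamma> where *: "x = a / b" "a \<in> part \<beta>" "b \<in> part \<gamma>" "b \<noteq> 0"
    using assms unfolding localization_homogeneous_iff by blast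
  have "level b (monom b 0)"
    using * by (auto simp: level_def below_def poly_component_monom intro!: exI[of _ "(0, \<gamma>)"])
  moreover have "below b (monom a 0) \<longleftrightarrow> x \<in> V"
    using * by (auto simp: below_def poly_component_monom)
  moreover have "to_fract [:x:] = Fract (monom a 0) (monom b 0)"
    using * by (simp add: to_fract_def eq_fract monom_0)
  ultimately show ?thesis
    using Fract_in_extension_iff[of "monom a 0" "monom b 0" b] * part_subset
    by (auto intro!: monom_in_polys_over subring)
qed

lemma to_fract_R_in_extension:
  assumes "a \<in> R"
  shows "to_fract [:a:] \<in> extension"
proof -
  have "[:a:] \<in> polys_over R" using monom_in_polys_over[OF subring assms, of 0] by (simp add: monom_0)
  moreover from this have "poly_component [:a:] s \<in> V" for s
    using poly_component_in_part part_subset R_subset_V by blast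
  then have "below 1 [:a:]" unfolding below_def by simp
  ultimately show ?thesis
    using Fract_in_extension_iff[OF _ one_in_polys_over level_one] by (simp add: to_fract_def)
qed

end

subsection \<open>The Kronecker function ring\<close>

lemma to_fract_const_inverse: "x \<noteq> 0 \<Longrightarrow> to_fract [:inverse x:] = inverse (to_fract [:x :: 'a :: field:])"
  by (simp add: to_fract_def eq_fract)

lemma subring_constants:
  assumes "is_subring W"
  shows "is_subring {x :: 'a::field. to_fract [:x:] \<in> W}"
proof -
  have "[:x:] + [:y:] = [:x + y:]" "[:x:] - [:y:] = [:x - y:]" "[:x:] * [:y:] = [:x * y:]" for x y :: 'a
    by simp_all
  then have "to_fract [:x + y:] = to_fract [:x:] + to_fract [:y:]"
    "to_fract [:x - y:] = to_fract [:x:] - to_fract [:y:]"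
    "to_fract [:x * y:] = to_fract [:x:] * to_fract [:y:]" for x y :: 'a
    by (metis to_fract_add to_fract_diff to_fract_mult)+
  moreover have "to_fract [:0:] = (0 :: 'a poly fract)" "to_fract [:1:] = (1 :: 'a poly fract)"
    by (simp_all flip: one_pCons)
  ultimately show ?thesis
    using assms unfolding is_subring_def by simp
qed

context graded_domain
begin

abbreviation (input) Kr :: "'k poly fract set" where "Kr \<equiv> Kr_h \<Gamma> R G"
abbreviation (input) content :: "'k poly \<Rightarrow> 'k set" where "content \<equiv> poly_content_ideal \<Gamma> R G"

lemma homogeneous_componentsD:
  assumes "y \<in> homogeneous_components \<Gamma> G a"
  shows "\<exists>\<alpha>. y = component a \<alpha>"
proof -
  obtain F x \<alpha> where F: "finite F" "F \<subseteq> \<Gamma>" "\<forall>\<beta>\<in>F. x \<beta> \<in> G \<beta>" "a = (\<Sum>\<beta>\<in>F. x \<beta>)" "\<alpha> \<in> F" "y = x \<alpha>"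
    using assms unfolding homogeneous_components_def by blast
  then have "is_decomposition a (\<lambda>\<beta>. if \<beta> \<in> F then x \<beta> else 0)"
    by (intro is_decompositionI[of F]) (auto simp: part_def intro: add_subgroup_zero parts)
  then have "component a = (\<lambda>\<beta>. if \<beta> \<in> F then x \<beta> else 0)" by (rule is_decomposition_iff)
  then have "y = component a \<alpha>" using F by simp
  then show ?thesis by blast
qed

lemma component_in_homogeneous_components:
  assumes "a \<in> R" "\<alpha> \<in> \<Gamma>"
  shows "component a \<alpha> \<in> homogeneous_components \<Gamma> G a"
proof -
  let ?F = "insert \<alpha> {\<alpha>. component a \<alpha> \<noteq> 0}"
  have sub: "?F \<subseteq> \<Gamma>" using assms component_in_part degree_in_monoid by blast
  moreover have "\<forall>\<beta>\<in>?F. component a \<beta> \<in> G \<beta>"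
    using sub component_in_part[OF assms(1)] unfolding part_def by (metis subsetD)
  moreover have "a = (\<Sum>\<beta>\<in>?F. component a \<beta>)"
    by (rule is_decomposition_sum[OF is_decomposition_component[OF assms(1)], symmetric])
      (use finite_components[OF assms(1)] in auto)
  ultimately show ?thesis
    unfolding homogeneous_components_def using finite_components[OF assms(1)]
    by (intro CollectI exI[of _ ?F] exI[of _ "component a"] exI[of _ \<alpha>]) auto
qed

text \<open>Together with \<open>component_in_content\<close>, this lets inclusions of content
  ideals be checked on single components.\<close>

lemma content_leastI:
  assumes I: "is_add_subgroup I" and "\<And>s r. r \<in> R \<Longrightarrow> poly_component f s * r \<in> I"
  shows "content f \<subseteq> I"
  unfolding poly_content_ideal_def content_ideal_def
proof (intro sum_family_leastI I span_prod_leastI)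
  fix i a b assume "a \<in> homogeneous_components \<Gamma> G (coeff f i)" "b \<in> R"
  moreover from this obtain \<alpha> where "a = poly_component f (i, \<alpha>)"
    using homogeneous_componentsD by (auto simp: poly_component_def)
  ultimately show "a * b \<in> I" using assms(2) by blast
qed

lemma component_in_content:
  assumes f: "f \<in> polys_over R" and r: "r \<in> R"
  shows "poly_component f s * r \<in> content f"
proof (cases "poly_component f s = 0")
  case True
  then show ?thesis unfolding poly_content_ideal_def using zero_in_sum_family by simp
next
  case False
  have "fst s \<le> degree f"
    using False by (auto simp: poly_component_def intro!: le_degree)
  moreover have "snd s \<in> \<Gamma>" using False poly_component_in_part[OF f] degree_in_monoid by blast
  then have "poly_component f s * r \<in> content_ideal \<Gamma> R G (coeff f (fst s))"
    unfolding content_ideal_def poly_component_def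
    by (intro prod_in_span_prod component_in_homogeneous_components coeff_polys_over f r)
  ultimately show ?thesis
    unfolding poly_content_ideal_def
    using subset_sum_family[of "fst s" "{..degree f}" "\<lambda>i. content_ideal \<Gamma> R G (coeff f i)"] by blast
qed

lemma content_subset:
  assumes "f \<in> polys_over R"
  shows "content f \<subseteq> R"
proof (rule content_leastI)
  show "is_add_subgroup R" using subring by (simp add: is_subring_def is_add_subgroup_def)
  show "poly_component f s * r \<in> R" if "r \<in> R" for s r
    using subring_mult[OF subring _ that] poly_component_in_part[OF assms] part_subset by blast
qed

lemma R_subset_content:
  assumes "f \<in> polys_over R" "poly_component f s = 1"
  shows "R \<subseteq> content f"
  using component_in_content[OF assms(1), of _ s] assms(2) by auto

text \<open>The choice \<open>h = 1\<close> suffices, because every module lies in its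
  \<open>b\<close>-closure.\<close>

lemma Fract_in_Kr_hI:
  assumes "f \<in> polys_over R" "g \<in> polys_over R" "g \<noteq> 0" "content f \<subseteq> content g"
  shows "Fract f g \<in> Kr"
proof -
  have "E \<subseteq> b_operation R E" for E
    unfolding b_operation_def using subset_span_prod_ring
    by (auto simp: Zar_def valuation_ring_def)
  moreover have "span_prod (content f) (content 1) \<subseteq> span_prod (content g) (content 1)"
    by (rule span_prod_mono) (rule assms(4))
  ultimately show ?thesis
    unfolding Kr_h_def using assms one_in_polys_over
    by (intro CollectI exI[of _ f] exI[of _ g]) (auto intro!: bexI[of _ 1])
qed

lemma polys_over_in_Kr_h:
  assumes "f \<in> polys_over R"
  shows "to_fract f \<in> Kr"
  unfolding to_fract_def
  using content_subset[OF assms] R_subset_content[OF one_in_polys_over, of "(0, 0)"]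
  by (intro Fract_in_Kr_hI assms one_in_polys_over) (auto simp: poly_component_one)

text \<open>These quotients force every valuation ring over \<open>Kr\<close> to give
  \<open>f\<close> at most the value of each of its components. As \<open>c\<close> is homogeneous,
  the content of the constant \<open>c\<close> lies in \<open>c R\<close>, and hence in the content
  of \<open>f\<close>.\<close>

lemma component_quotient_in_Kr_h:
  assumes f: "f \<in> polys_over R" "f \<noteq> 0"
  shows "Fract [:poly_component f s:] f \<in> Kr"
proof (rule Fract_in_Kr_hI)
  define c where "c = poly_component f s"
  have c: "c \<in> part (snd s)" using poly_component_in_part[OF f(1)] by (simp add: c_def)
  then have "c \<in> R" using part_subset by blast
  then show "[:c:] \<in> polys_over R"
    using monom_in_polys_over[OF subring, of c 0] by (simp add: monom_0)
  have comp: "poly_component [:c:] t = (if t = (0, snd s) then c else 0)" for t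
    using poly_component_monom[OF c, of 0 t] by (simp add: monom_0)
  have zero: "0 \<in> content f" unfolding poly_content_ideal_def by (rule zero_in_sum_family)
  have "content [:c:] \<subseteq> {c * r | r. r \<in> R}"
  proof (rule content_leastI)
    show "is_add_subgroup {c * r | r. r \<in> R}"
      unfolding is_add_subgroup_def
      using subring_zero[OF subring] subring_diff[OF subring]
      by (auto simp flip: right_diff_distrib)
    show "poly_component [:c:] t * r \<in> {c * r | r. r \<in> R}" if "r \<in> R" for t r
      using that subring_zero[OF subring] by (auto simp: comp)
  qed
  also have "\<dots> \<subseteq> content f" using component_in_content[OF f(1)] unfolding c_def by blast
  finally show "content [:c:] \<subseteq> content f" .
qed (rule f)+

lemma quotient_field_Kr_h: "quotient_field Kr = UNIV"
proof -
  have "F \<in> quotient_field Kr" for F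
  proof -
    obtain f g where "F = Fract f g" "f \<in> polys_over R" "g \<in> polys_over R" "g \<noteq> 0"
      by (rule fract_cases_polys_over)
    then have "F = to_fract f / to_fract g \<and> to_fract f \<in> Kr \<and> to_fract g \<in> Kr \<and> to_fract g \<noteq> 0"
      by (simp add: polys_over_in_Kr_h Fract_conv_to_fract)
    then show ?thesis unfolding quotient_field_def by blast
  qed
  then show ?thesis by blast
qed

text \<open>By \<open>quotient_field_Kr_h\<close> the conditions of \<open>Zar\<close> on quotient
  fields amount to totality on all of \<open>K(X)\<close>.\<close>

lemma Zar_Kr_h_iff:
  "W \<in> Zar Kr \<longleftrightarrow> is_subring W \<and> Kr \<subseteq> W \<and> (\<forall>x. x \<noteq> 0 \<longrightarrow> x \<in> W \<or> inverse x \<in> W)"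
  using valuation_ringI[of W] unfolding Zar_def quotient_field_Kr_h
  by (auto simp: valuation_ring_def)

lemma Zar_to_Zar_h_eq:
  "Zar_to_Zar_h \<Gamma> G W =
    sum_family (quotient_group \<Gamma>) (\<lambda>\<alpha>. hom_localization_part \<Gamma> G \<alpha> \<inter> {x. to_fract [:x:] \<in> W})"
  unfolding Zar_to_Zar_h_def by (simp add: Int_def)

text \<open>The instance of \<open>homogeneous_part_in_Zar_h\<close> where \<open>C\<close> consists
  of the constants in \<open>W\<close>; \<open>R\<close> lies among them because constant
  polynomials over \<open>R\<close> belong to \<open>Kr\<close>.\<close>

lemma Zar_to_Zar_h_props:
  assumes W: "W \<in> Zar Kr"
  shows "Zar_to_Zar_h \<Gamma> G W \<in> Zar_h \<Gamma> R G"
    and "x \<in> hom_localization_homogeneous \<Gamma> G \<Longrightarrow> x \<in> Zar_to_Zar_h \<Gamma> G W \<longleftrightarrow> to_fract [:x:] \<in> W"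
proof -
  let ?C = "{x. to_fract [:x:] \<in> W}"
  have W': "is_subring W" "Kr \<subseteq> W" "\<And>x. x \<noteq> 0 \<Longrightarrow> x \<in> W \<or> inverse x \<in> W"
    using W Zar_Kr_h_iff by blast+
  have "R \<subseteq> ?C"
    using monom_in_polys_over[OF subring, of _ 0] polys_over_in_Kr_h W'(2) by (auto simp: monom_0)
  moreover have "x \<in> ?C \<or> inverse x \<in> ?C" if "x \<noteq> 0" for x
    using W'(3)[of "to_fract [:x:]"] that by (simp add: to_fract_const_inverse)
  ultimately show "Zar_to_Zar_h \<Gamma> G W \<in> Zar_h \<Gamma> R G"
    and "x \<in> hom_localization_homogeneous \<Gamma> G \<Longrightarrow> x \<in> Zar_to_Zar_h \<Gamma> G W \<longleftrightarrow> to_fract [:x:] \<in> W"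
    using homogeneous_part_in_Zar_h[OF subring_constants[OF W'(1)]] unfolding Zar_to_Zar_h_eq by auto
qed

end

section \<open>Surjectivity of the canonical map\<close>

context gr_valuation
begin

text \<open>This trace of \<open>extension\<close> on \<open>K\<close> is the valuation overring of
  \<open>R\<close> at which the \<open>b\<close>-operation is evaluated in
  \<open>Kr_h_subset_extension\<close>.\<close>

lemma constants_in_Zar: "{x. to_fract [:x:] \<in> extension} \<in> Zar R"
proof -
  let ?U = "{x. to_fract [:x:] \<in> extension}"
  have U: "is_subring ?U" by (rule subring_constants[OF subring_extension])
  have total: "x \<in> ?U \<or> inverse x \<in> ?U" if "x \<noteq> 0" for x
    using extension_total[of "to_fract [:x:]"] that by (simp add: to_fract_const_inverse)
  show ?thesis
    using valuation_ringI[OF U total] to_fract_R_in_extension by (auto simp: Zar_def quotient_field)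
qed

text \<open>The \<open>b\<close>-closure lies in the extension to the single valuation ring
  \<open>?U\<close>. Minimal components \<open>d\<close> of \<open>g\<close> and \<open>e\<close> of
  \<open>h\<close> bound that extension by \<open>d e ?U\<close>. Each component of \<open>f\<close>
  times \<open>e\<close> lies there, and cancelling \<open>e\<close> leaves it in
  \<open>d ?U\<close>.\<close>

lemma Kr_h_subset_extension: "Kr_h \<Gamma> R G \<subseteq> extension"
proof
  fix F assume "F \<in> Kr_h \<Gamma> R G"
  then obtain f g h where F: "F = Fract f g" and f: "f \<in> polys_over R" and g: "g \<in> polys_over R" "g \<noteq> 0"
    and h: "h \<in> polys_over R" "h \<noteq> 0"
    and sub: "span_prod (content f) (content h) \<subseteq> b_operation R (span_prod (content g) (content h))"
    unfolding Kr_h_def by blast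
  let ?U = "{x. to_fract [:x:] \<in> extension}"
  have U: "is_subring ?U" by (rule subring_constants[OF subring_extension])
  have U_sub: "is_add_subgroup {z. z / e \<in> ?U}" for e
    using U unfolding is_subring_def is_add_subgroup_def by (simp add: diff_divide_distrib)
  \<comment> \<open>\<open>?U\<close> may contain inhomogeneous elements, but it agrees with
    \<open>V\<close> on quotients of homogeneous ones; this allows the return to \<open>V\<close> at
    the end.\<close>
  have U_iff: "x / y \<in> ?U \<longleftrightarrow> x / y \<in> V" if "x \<in> part \<alpha>" "y \<in> part \<beta>" "y \<noteq> 0" for x y \<alpha> \<beta>
    using const_in_extension_iff[of "x / y"] that unfolding localization_homogeneous_iff by blast
  have RU: "R \<subseteq> ?U" using to_fract_R_in_extension by blast
  have content: "content p \<subseteq> {z. z / e \<in> ?U}" if p: "p \<in> polys_over R" and e: "level e p" for p e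
  proof (rule content_leastI[OF U_sub])
    fix s r assume "r \<in> R"
    have "poly_component p s / e \<in> ?U"
      using e belowD[OF level_imp_below[OF e], of s] U_iff poly_component_in_part[OF p] unfolding level_def by blast
    then have "(poly_component p s / e) * r \<in> ?U" using subring_mult[OF U] RU \<open>r \<in> R\<close> by blast
    then show "poly_component p s * r \<in> {z. z / e \<in> ?U}" by simp
  qed
  obtain t where t: "poly_component g t \<noteq> 0" "level (poly_component g t) g"
    using exists_level_component[OF g] by blast
  obtain u where u: "poly_component h u \<noteq> 0" "level (poly_component h u) h"
    using exists_level_component[OF h] by blast
  define d e where "d = poly_component g t" and "e = poly_component h u"
  have "span_prod (span_prod (content g) (content h)) ?U \<subseteq> {z. z / (d * e) \<in> ?U}"
  proof (rule span_prod_leastI[OF U_sub])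
    fix z r assume z: "z \<in> span_prod (content g) (content h)" and r: "r \<in> ?U"
    have "span_prod (content g) (content h) \<subseteq> {z. z / (d * e) \<in> ?U}"
    proof (rule span_prod_leastI[OF U_sub])
      fix a b assume "a \<in> content g" "b \<in> content h"
      then have "a / d \<in> ?U" "b / e \<in> ?U"
        using content[OF g(1) t(2)] content[OF h(1) u(2)] by (auto simp: d_def e_def)
      then have "(a / d) * (b / e) \<in> ?U" by (rule subring_mult[OF U])
      then show "a * b \<in> {z. z / (d * e) \<in> ?U}" by simp
    qed
    then have "z / (d * e) * r \<in> ?U" using z r subring_mult[OF U] by blast
    then show "z * r \<in> {z. z / (d * e) \<in> ?U}" by simp
  qed
  then have sub: "span_prod (content f) (content h) \<subseteq> {z. z / (d * e) \<in> ?U}"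
    using sub constants_in_Zar unfolding b_operation_def by blast
  have "below d f"
    unfolding below_def
  proof
    fix s
    have one: "1 \<in> R" by (rule subring_one[OF subring])
    \<comment> \<open>The factor \<open>e\<close> is itself a component of \<open>h\<close>, hence
      an element of its content.\<close>
    have "poly_component f s * e \<in> span_prod (content f) (content h)"
      using component_in_content[OF f one, of s] component_in_content[OF h(1) one, of u]
      by (intro prod_in_span_prod) (simp_all add: e_def)
    then have "poly_component f s * e / (d * e) \<in> ?U" using sub by blast
    then have "poly_component f s / d \<in> ?U" using u by (simp add: e_def)
    then show "poly_component f s / d \<in> V"
      using U_iff[OF poly_component_in_part[OF f] poly_component_in_part[OF g(1)] t(1)] by (simp add: d_def)
  qed
  then show "F \<in> extension"
    using Fract_in_extension_iff[OF f g(1)] t F by (simp add: d_def)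
qed

lemma extension_in_Zar: "extension \<in> Zar (Kr_h \<Gamma> R G)"
  unfolding Zar_Kr_h_iff using subring_extension Kr_h_subset_extension extension_total by blast

text \<open>By \<open>V_eq\<close> both sides are sums of their homogeneous elements, and these
  agree by \<open>const_in_extension_iff\<close>.\<close>

lemma Zar_to_Zar_h_extension: "Zar_to_Zar_h \<Gamma> G extension = V"
proof -
  have "hom_localization_part \<Gamma> G \<alpha> \<inter> {x. to_fract [:x:] \<in> extension} = V \<inter> hom_localization_part \<Gamma> G \<alpha>"
    if "\<alpha> \<in> quotient_group \<Gamma>" for \<alpha>
    using const_in_extension_iff that unfolding hom_localization_homogeneous_def by blast
  then have "Zar_to_Zar_h \<Gamma> G extension = sum_family (quotient_group \<Gamma>) (\<lambda>\<alpha>. V \<inter> hom_localization_part \<Gamma> G \<alpha>)"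
    unfolding Zar_to_Zar_h_eq by (intro equalityI sum_family_mono) blast+
  then show ?thesis using V_eq by simp
qed

end

section \<open>Injectivity of the canonical map\<close>

context graded_domain
begin

text \<open>With \<open>d\<close> minimal for \<open>g\<close>, one inclusion uses
  \<open>f / g = (f / d) * (d / g)\<close>; the other uses
  \<open>c / d = (c / f) * (f / g) * (g / d)\<close> with \<open>c\<close> minimal for
  \<open>f\<close>. The facts \<open>quot\<close> and \<open>inv\<close> put the auxiliary factors
  into \<open>W\<close>.\<close>

lemma extension_Zar_to_Zar_h:
  assumes W: "W \<in> Zar Kr"
  shows "gr_valuation.extension \<Gamma> R G (Zar_to_Zar_h \<Gamma> G W) = W"
proof -
  define V where "V = Zar_to_Zar_h \<Gamma> G W"
  interpret gr_valuation \<Gamma> R G V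
    by unfold_locales (use Zar_to_Zar_h_props(1)[OF W] in \<open>simp add: V_def\<close>)
  have W': "is_subring W" "Kr \<subseteq> W" using W Zar_Kr_h_iff by blast+
  have V_iff: "x / y \<in> V \<longleftrightarrow> to_fract [:x / y:] \<in> W"
    if "x \<in> part \<alpha>" "y \<in> part \<beta>" "y \<noteq> 0" for x y \<alpha> \<beta>
    using Zar_to_Zar_h_props(2)[OF W, of "x / y"] that unfolding localization_homogeneous_iff V_def by blast
  have X: "to_fract (monom 1 n) \<in> W" for n
    using polys_over_in_Kr_h[OF monom_in_polys_over[OF subring subring_one[OF subring]]] W'(2) by blast
  have const: "Fract [:x:] [:y:] = to_fract [:x / y:]" if "y \<noteq> 0" for x y :: 'k
    using that by (simp add: to_fract_def eq_fract)
  \<comment> \<open>Dividing by \<open>c\<close> turns the components of \<open>f\<close> into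
    elements of \<open>V\<close>, which are constants in \<open>W\<close>; the powers of
    \<open>X\<close> lie in \<open>W\<close> as well.\<close>
  have quot: "Fract f [:c:] \<in> W"
    if f: "f \<in> polys_over R" and c: "c \<noteq> 0" "c \<in> part \<alpha>" "below c f" for f c \<alpha>
  proof -
    have "Fract f [:c:] = to_fract (smult (inverse c) f)" using c by (simp add: to_fract_def eq_fract)
    also have "smult (inverse c) f = (\<Sum>s\<in>support f. [:poly_component f s / c:] * monom 1 (fst s))"
    proof -
      have "smult (inverse c) f = [:inverse c:] * (\<Sum>s\<in>support f. monom (poly_component f s) (fst s))"
        by (simp add: poly_eq_sum_components[OF f])
      also have "\<dots> = (\<Sum>s\<in>support f. [:poly_component f s / c:] * monom 1 (fst s))"
        unfolding sum_distrib_left by (simp add: smult_monom divide_inverse mult.commute)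
      finally show ?thesis .
    qed
    also have "to_fract \<dots> = (\<Sum>s\<in>support f. to_fract [:poly_component f s / c:] * to_fract (monom 1 (fst s)))"
      by (simp only: to_fract_sum to_fract_mult)
    also have "\<dots> \<in> W"
      using belowD[OF c(3)] V_iff[OF poly_component_in_part[OF f] c(2,1)]
      by (intro subring_sum subring_mult W'(1) X) blast
    finally show ?thesis .
  qed
  \<comment> \<open>The quotient \<open>c / f\<close> passes through a component \<open>a\<close> of
    \<open>f\<close> with \<open>c / a \<in> V\<close>; the remaining factor \<open>a / f\<close> is
    in \<open>Kr\<close>.\<close>
  have inv: "Fract [:c:] f \<in> W"
    if f: "f \<in> polys_over R" "f \<noteq> 0" and c: "level c f" for f c
  proof -
    obtain s where s: "poly_component f s \<noteq> 0" "c / poly_component f s \<in> V"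
      using c by (auto simp: level_def)
    have "to_fract [:c / poly_component f s:] \<in> W"
      using s c V_iff poly_component_in_part[OF f(1)] unfolding level_def by blast
    moreover have "Fract [:poly_component f s:] f \<in> W"
      using component_quotient_in_Kr_h[OF f] W'(2) by blast
    moreover have "Fract [:c:] f = to_fract [:c / poly_component f s:] * Fract [:poly_component f s:] f"
      using s by (simp add: to_fract_def)
    ultimately show ?thesis using subring_mult[OF W'(1)] by metis
  qed
  have "F \<in> extension \<longleftrightarrow> F \<in> W" for F
  proof -
    obtain f g d where F: "F = Fract f g" "f \<in> polys_over R" "g \<in> polys_over R" "g \<noteq> 0" "level d g"
      by (rule fract_level_cases)
    obtain \<delta> where d: "d \<noteq> 0" "d \<in> part \<delta>" using F(5) by (auto simp: level_def)
    have "below d f \<longleftrightarrow> Fract f g \<in> W"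
    proof
      assume "below d f"
      then have "Fract f [:d:] * Fract [:d:] g \<in> W"
        using quot[OF F(2) d] inv[OF F(3-5)] subring_mult[OF W'(1)] by blast
      moreover have "Fract f [:d:] * Fract [:d:] g = Fract f g"
        using d F(4) by (simp add: eq_fract)
      ultimately show "Fract f g \<in> W" by simp
    next
      assume fg: "Fract f g \<in> W"
      show "below d f"
      proof (cases "f = 0")
        case False
        then obtain c where c: "level c f" using exists_level_component[OF F(2)] by blast
        then obtain \<gamma> where \<gamma>: "c \<in> part \<gamma>" by (auto simp: level_def)
        have "Fract [:c:] f * Fract f g * Fract g [:d:] \<in> W"
          using inv[OF F(2) False c] fg quot[OF F(3) d level_imp_below[OF F(5)]] subring_mult[OF W'(1)] by blast
        moreover have "Fract [:c:] f * Fract f g * Fract g [:d:] = to_fract [:c / d:]"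
          using d False F(4) by (simp add: eq_fract flip: const)
        ultimately have "c / d \<in> V" using V_iff[OF \<gamma> d(2,1)] by simp
        then show ?thesis using below_trans[OF level_imp_below[OF c]] level_nonzero[OF c] by blast
      qed simp
    qed
    then show ?thesis using Fract_in_extension_iff[OF F(2,3,5)] F(1) by blast
  qed
  then show ?thesis unfolding V_def by blast
qed

section \<open>Continuity in both directions\<close>

lemma Zar_to_Zar_h_preimage:
  assumes u: "u \<in> hom_localization_homogeneous \<Gamma> G"
  shows "Zar_to_Zar_h \<Gamma> G -` {V \<in> Zar_h \<Gamma> R G. u \<in> V} \<inter> Zar Kr = {W \<in> Zar Kr. to_fract [:u:] \<in> W}"
  using Zar_to_Zar_h_props u by auto

lemma openin_Zar_h: "u \<in> hom_localization_homogeneous \<Gamma> G \<Longrightarrow> openin (Zar_h_topology \<Gamma> R G) {V \<in> Zar_h \<Gamma> R G. u \<in> V}"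
  unfolding Zar_h_topology_def by (rule topology_generated_by_Basis) blast

text \<open>This gives continuity of the inverse map. For each candidate position \<open>t\<close>
  in \<open>g\<close>, only finitely many homogeneous quotients have to lie in \<open>V\<close>,
  which is a finite intersection of subbasic sets; the union over all \<open>t\<close> remains
  open.\<close>

lemma openin_extension:
  "openin (Zar_h_topology \<Gamma> R G) {V \<in> Zar_h \<Gamma> R G. F \<in> gr_valuation.extension \<Gamma> R G V}"
proof -
  obtain f g where F: "F = Fract f g" "f \<in> polys_over R" "g \<in> polys_over R" "g \<noteq> 0"
    by (rule fract_cases_polys_over)
  define T where "T = {t. poly_component g t \<noteq> 0}"
  \<comment> \<open>\<open>undefined\<close> keeps \<open>S\<close> nonempty, so that the intersections below stay inside \<open>Zar_h \<Gamma> R G\<close>.\<close>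
  define S where "S = insert undefined (support f \<union> support g)"
  \<comment> \<open>For \<open>t \<in> T\<close>, \<open>N t\<close> says that \<open>g\<close>
    attains its minimum at \<open>t\<close> and that this value bounds \<open>f\<close> from
    below.\<close>
  define N where "N t = (\<Inter>s\<in>S. {V \<in> Zar_h \<Gamma> R G. poly_component g s / poly_component g t \<in> V} \<inter>
     {V \<in> Zar_h \<Gamma> R G. poly_component f s / poly_component g t \<in> V})" for t
  have S: "finite S" "S \<noteq> {}" using finite_support F by (auto simp: S_def)
  have hom: "poly_component p s / poly_component g t \<in> hom_localization_homogeneous \<Gamma> G"
    if "p \<in> polys_over R" "t \<in> T" for p s t
    using that poly_component_in_part F(3) unfolding localization_homogeneous_iff T_def by blast
  have "openin (Zar_h_topology \<Gamma> R G) (N t)" if "t \<in> T" for t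
    unfolding N_def using S that F
    by (intro openin_INT2 openin_Int openin_Zar_h hom) auto
  then have "openin (Zar_h_topology \<Gamma> R G) (\<Union>t\<in>T. N t)" by (intro openin_Union) auto
  also have "(\<Union>t\<in>T. N t) = {V \<in> Zar_h \<Gamma> R G. F \<in> gr_valuation.extension \<Gamma> R G V}"
  proof (intro set_eqI)
    fix V
    show "V \<in> (\<Union>t\<in>T. N t) \<longleftrightarrow> V \<in> {V \<in> Zar_h \<Gamma> R G. F \<in> gr_valuation.extension \<Gamma> R G V}"
    proof (cases "V \<in> Zar_h \<Gamma> R G")
      case False
      then show ?thesis using S by (auto simp: N_def)
    next
      case True
      then interpret gr_valuation \<Gamma> R G V by unfold_locales
      \<comment> \<open>Components at positions outside \<open>S\<close> are zero, so the infinitely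
        many conditions in \<open>below\<close> reduce to those on the finite set
        \<open>S\<close>.\<close>
      have below_iff: "below c p \<longleftrightarrow> (\<forall>s\<in>S. poly_component p s / c \<in> V)" if "support p \<subseteq> S" for c p
      proof -
        have "poly_component p s / c \<in> V" if "s \<notin> S" for s
        proof -
          have "poly_component p s = 0" using that \<open>support p \<subseteq> S\<close> unfolding support_def by blast
          then show ?thesis by simp
        qed
        then show ?thesis unfolding below_def by blast
      qed
      have "V \<in> N t \<longleftrightarrow> below (poly_component g t) g \<and> below (poly_component g t) f" for t
        using True below_iff[of g] below_iff[of f] S by (auto simp: N_def S_def)
      moreover have "F \<in> extension \<longleftrightarrow> (\<exists>t\<in>T. below (poly_component g t) g \<and> below (poly_component g t) f)"
      proof
        assume "F \<in> extension"
        obtain t where t: "poly_component g t \<noteq> 0" "below (poly_component g t) g" "level (poly_component g t) g"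
          using exists_level_component[OF F(3,4)] by blast
        then show "\<exists>t\<in>T. below (poly_component g t) g \<and> below (poly_component g t) f"
          using Fract_in_extension_iff[OF F(2,3) t(3)] \<open>F \<in> extension\<close> F(1)
          unfolding T_def by blast
      qed (use F in \<open>auto simp: extension_def T_def\<close>)
      ultimately show ?thesis using True by blast
    qed
  qed
  finally show ?thesis .
qed

text \<open>Continuity is checked on the generating sets only; the two inverse laws are
  \<open>extension_Zar_to_Zar_h\<close> and \<open>Zar_to_Zar_h_extension\<close>.\<close>

lemma homeomorphic_maps_Zar:
  "homeomorphic_maps (Zar_topology Kr) (Zar_h_topology \<Gamma> R G)
    (Zar_to_Zar_h \<Gamma> G) (gr_valuation.extension \<Gamma> R G)"
proof -
  have topspace_h: "topspace (Zar_h_topology \<Gamma> R G) = Zar_h \<Gamma> R G"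
    by (rule topspace_Zar_h_topology) unfold_locales
  \<comment> \<open>Argued directly from \<open>quotient_field_Kr_h\<close>, since
    \<open>topspace_Zar_topology\<close> asks for \<open>Kr\<close> to be a subring, which is not
    established separately.\<close>
  have topspace: "topspace (Zar_topology Kr) = Zar Kr"
  proof -
    have "W \<in> Zar Kr \<Longrightarrow> 1 \<in> W" for W using Zar_Kr_h_iff subring_one by blast
    then show ?thesis unfolding Zar_topology_def by (auto simp: Union_eq quotient_field_Kr_h)
  qed
  have gr: "gr_valuation \<Gamma> R G V" if "V \<in> Zar_h \<Gamma> R G" for V
    using that by unfold_locales
  have open_W: "openin (Zar_topology Kr) {W \<in> Zar Kr. x \<in> W}" for x
    unfolding Zar_topology_def by (rule topology_generated_by_Basis) (auto simp: quotient_field_Kr_h)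
  show ?thesis
    unfolding homeomorphic_maps_def
  proof (intro conjI ballI)
    show "continuous_map (Zar_topology Kr) (Zar_h_topology \<Gamma> R G) (Zar_to_Zar_h \<Gamma> G)"
      unfolding Zar_h_topology_def
    proof (rule continuous_on_generated_topo)
      fix U assume "U \<in> {{V \<in> Zar_h \<Gamma> R G. u \<in> V} | u. u \<in> hom_localization_homogeneous \<Gamma> G}"
      then show "openin (Zar_topology Kr) (Zar_to_Zar_h \<Gamma> G -` U \<inter> topspace (Zar_topology Kr))"
        using Zar_to_Zar_h_preimage open_W unfolding topspace by auto
    next
      show "Zar_to_Zar_h \<Gamma> G ` topspace (Zar_topology Kr) \<subseteq>
          \<Union> {{V \<in> Zar_h \<Gamma> R G. u \<in> V} | u. u \<in> hom_localization_homogeneous \<Gamma> G}"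
        using Zar_to_Zar_h_props(1) topspace_h
        unfolding Zar_h_topology_def topology_generated_by_topspace topspace by blast
    qed
    show "continuous_map (Zar_h_topology \<Gamma> R G) (Zar_topology Kr) (gr_valuation.extension \<Gamma> R G)"
      unfolding Zar_topology_def
    proof (rule continuous_on_generated_topo)
      fix U assume "U \<in> {{W \<in> Zar Kr. x \<in> W} | x. x \<in> quotient_field Kr}"
      then obtain F where U: "U = {W \<in> Zar Kr. F \<in> W}" by blast
      have "gr_valuation.extension \<Gamma> R G -` U \<inter> Zar_h \<Gamma> R G =
          {V \<in> Zar_h \<Gamma> R G. F \<in> gr_valuation.extension \<Gamma> R G V}"
        using gr_valuation.extension_in_Zar[OF gr] by (auto simp: U)
      then show "openin (Zar_h_topology \<Gamma> R G)
          (gr_valuation.extension \<Gamma> R G -` U \<inter> topspace (Zar_h_topology \<Gamma> R G))"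
        using openin_extension unfolding topspace_h by simp
    next
      show "gr_valuation.extension \<Gamma> R G ` topspace (Zar_h_topology \<Gamma> R G) \<subseteq>
          \<Union> {{W \<in> Zar Kr. x \<in> W} | x. x \<in> quotient_field Kr}"
        using gr_valuation.extension_in_Zar[OF gr] topspace
        unfolding Zar_topology_def topology_generated_by_topspace topspace_h by blast
    qed
  qed (use extension_Zar_to_Zar_h gr_valuation.Zar_to_Zar_h_extension[OF gr] topspace topspace_h in auto)
qed

end

theorem theorem8:
  fixes \<Gamma> :: "'g::ab_group_add set" and R :: "'k::field set" and G :: "'g \<Rightarrow> 'k set"
  assumes "graded_domain \<Gamma> R G"
  shows "homeomorphic_map (Zar_topology (Kr_h \<Gamma> R G)) (Zar_h_topology \<Gamma> R G)
           (Zar_to_Zar_h \<Gamma> G)"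
  using graded_domain.homeomorphic_maps_Zar[OF assms] by (rule homeomorphic_maps_imp_map)

end
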